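(* Let $S$ be a compact connected surface with nonempty boundary. If $S$ admits a polyhedral embedding into $\mathbb{R}^n$ that is substantial and tight, then $n \leq c_0(S)-1$, where $c_0(S)$ is the relative chromatic number of $S$.
   Context: Relative chromatic number: for a finite graph $G$ and a compact surface $S$ with boundary, a proper embedding of $G$ in $S$ is a (topological) embedding of $G$ in $S$ sending every vertex of $G$ to a point of $\partial S$ (edges may pass through the interior of $S$). The relative chromatic number $c_0(S)$ is the supremum of the chromatic numbers of the finite graphs that admit a proper embedding in $S$. Polyhedral embedding: a topological embedding $\varphi: S\to\mathbb{R}^n$ for which $S$ has a finite cell decomposition into vertices, edges and polygonal faces such that edges are mapped to straight segments and faces to planar polygons. Substantial: an embedding $\varphi:S\to\mathbb{R}^n$ is substantial if its image is not contained in an affine hyperplane of $\mathbb{R}^n$. Tight: an embedding $\varphi:S\to\mathbb{R}^n$ is $p$-tight if for every open affine half-space $E\subset\mathbb{R}^n$ the homology morphism $H_p(\varphi(S)\cap E;\mathbb{Z}/2)\to H_p(\varphi(S);\mathbb{Z}/2)$ induced by inclusion is injective. It is tight if it is $p$-tight for every $p$. *)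

theory Defs
  imports "HOL-Analysis.Analysis" "HOL-Homology.Homology" "HOL-Library.Z2" "HOL-Library.Extended_Nat"
    "HOL-Library.Disjoint_Sets" "HOL-Library.Ramsey"
begin

section \<open>Surfaces with boundary\<close>

definition half_plane :: "(real^2) set" where
  "half_plane = {x. 0 \<le> x $ 2}"

definition surface :: "'a topology \<Rightarrow> bool" where
  "surface X \<longleftrightarrow> Hausdorff_space X \<and> second_countable X \<and>
     (\<forall>x \<in> topspace X. \<exists>U W. openin X U \<and> x \<in> U \<and> openin (top_of_set half_plane) W \<and>
        subtopology X U homeomorphic_space top_of_set W)"

definition surface_interior :: "'a topology \<Rightarrow> 'a set" where
  "surface_interior X = {x \<in> topspace X. \<exists>U (W :: (real^2) set). openin X U \<and> x \<in> U \<and> open W \<and>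
     subtopology X U homeomorphic_space top_of_set W}"

definition surface_boundary :: "'a topology \<Rightarrow> 'a set" where
  "surface_boundary X = topspace X - surface_interior X"


section \<open>Finite graphs and the relative chromatic number\<close>

definition finite_graph :: "'v set \<Rightarrow> 'v set set \<Rightarrow> bool" where
  "finite_graph V E \<longleftrightarrow> finite V \<and> E \<subseteq> nsets V 2"

definition proper_colouring :: "'v set \<Rightarrow> 'v set set \<Rightarrow> nat \<Rightarrow> ('v \<Rightarrow> nat) \<Rightarrow> bool" where
  "proper_colouring V E k c \<longleftrightarrow> c ` V \<subseteq> {..<k} \<and> (\<forall>u v. {u, v} \<in> E \<longrightarrow> c u \<noteq> c v)"

definition chromatic_number :: "'v set \<Rightarrow> 'v set set \<Rightarrow> nat" where
  "chromatic_number V E = (LEAST k. \<exists>c. proper_colouring V E k c)"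

text \<open>The geometric realization of a graph, in barycentric coordinates: the vertex \<open>v\<close> is the unit
  vector at \<open>v\<close>, and the edge \<open>{u, v}\<close> is the segment between the unit vectors at \<open>u\<close> and \<open>v\<close>.\<close>

definition vertex_point :: "'v \<Rightarrow> 'v \<Rightarrow> real" where
  "vertex_point v = (\<lambda>w. if w = v then 1 else 0)"

definition graph_realization :: "'v set \<Rightarrow> 'v set set \<Rightarrow> ('v \<Rightarrow> real) topology" where
  "graph_realization V E = subtopology (powertop_real UNIV)
     {x. (\<forall>v. 0 \<le> x v) \<and> {v. x v \<noteq> 0} \<in> (\<lambda>v. {v}) ` V \<union> E \<and> (\<Sum>v\<in>V. x v) = 1}"

definition proper_graph_embedding ::
    "'v set \<Rightarrow> 'v set set \<Rightarrow> 'a topology \<Rightarrow> (('v \<Rightarrow> real) \<Rightarrow> 'a) \<Rightarrow> bool" where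
  "proper_graph_embedding V E X g \<longleftrightarrow>
     embedding_map (graph_realization V E) X g \<and> (\<forall>v\<in>V. g (vertex_point v) \<in> surface_boundary X)"

text \<open>Every finite graph is isomorphic to one whose vertices are natural numbers, so the supremum
  ranges over those. It is taken in the extended natural numbers, as the supremum of an
  unbounded set of natural numbers would carry no meaning.\<close>

definition relative_chromatic_number :: "'a topology \<Rightarrow> enat" where
  "relative_chromatic_number X = Sup {enat (chromatic_number V E) | (V :: nat set) E.
     finite_graph V E \<and> (\<exists>g. proper_graph_embedding V E X g)}"


section \<open>Polyhedral embeddings\<close>

text \<open>\<open>E\<close> and \<open>F\<close> consist of the open edges and open faces. Cells are regular (closed cells are
  embedded), which is forced when closed cells are mapped injectively onto segments and polygons.\<close>

definition cell_decomposition :: "'a topology \<Rightarrow> 'a set \<Rightarrow> 'a set set \<Rightarrow> 'a set set \<Rightarrow> bool" where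
  "cell_decomposition X V E F \<longleftrightarrow>
     finite V \<and> finite E \<and> finite F \<and>
     partition_on (topspace X) ((\<lambda>v. {v}) ` V \<union> E \<union> F) \<and>
     (\<forall>e\<in>E. \<exists>h. embedding_map (top_of_set {0..1::real}) X h \<and>
        h ` {0<..<1} = e \<and> h 0 \<in> V \<and> h 1 \<in> V) \<and>
     (\<forall>f\<in>F. \<exists>h. embedding_map (top_of_set (cball (0::real^2) 1)) X h \<and>
        h ` ball 0 1 = f \<and>
        (\<exists>C \<subseteq> (\<lambda>v. {v}) ` V \<union> E. h ` sphere 0 1 = \<Union>C))"

text \<open>A closed disc in an affine plane bounded by finitely many segments; it need not be convex.\<close>

definition planar_polygon :: "('b::euclidean_space) set \<Rightarrow> bool" where
  "planar_polygon P \<longleftrightarrow> aff_dim P = 2 \<and> P homeomorphic cball (0::real^2) 1 \<and>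
     (\<exists>\<S>. finite \<S> \<and> (\<forall>s\<in>\<S>. \<exists>a b. s = closed_segment a b) \<and> rel_frontier P = \<Union>\<S>)"

definition polyhedral_embedding :: "'a topology \<Rightarrow> ('a \<Rightarrow> 'b::euclidean_space) \<Rightarrow> bool" where
  "polyhedral_embedding X \<phi> \<longleftrightarrow> embedding_map X euclidean \<phi> \<and>
     (\<exists>V E F. cell_decomposition X V E F \<and>
        (\<forall>e\<in>E. \<exists>a b. \<phi> ` (X closure_of e) = closed_segment a b) \<and>
        (\<forall>f\<in>F. planar_polygon (\<phi> ` (X closure_of f))))"

definition substantial :: "'a topology \<Rightarrow> ('a \<Rightarrow> 'b::euclidean_space) \<Rightarrow> bool" where
  "substantial X \<phi> \<longleftrightarrow> \<not> (\<exists>a b. a \<noteq> 0 \<and> \<phi> ` topspace X \<subseteq> {x. a \<bullet> x = b})"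


section \<open>Singular homology with coefficients in Z/2\<close>

text \<open>The library has singular homology with integer coefficients only. Its singular simplices,
  faces and induced maps on simplices are reused here; \<^typ>\<open>bit\<close> is the field with two elements,
  so no signs are needed in the boundary.\<close>

type_synonym 'a mod2_chain = "((nat \<Rightarrow> real) \<Rightarrow> 'a) \<Rightarrow>\<^sub>0 bit"

definition mod2_chain_group :: "nat \<Rightarrow> 'a topology \<Rightarrow> 'a mod2_chain monoid" where
  "mod2_chain_group p X =
     \<lparr>carrier = {c. Poly_Mapping.keys c \<subseteq> singular_simplex_set p X}, monoid.mult = (+), one = 0\<rparr>"

definition mod2_boundary :: "nat \<Rightarrow> 'a mod2_chain \<Rightarrow> 'a mod2_chain" where
  "mod2_boundary p c = (if p = 0 then 0 else
     \<Sum>s\<in>Poly_Mapping.keys c. \<Sum>k\<le>p. Poly_Mapping.single (singular_face p k s) (Poly_Mapping.lookup c s))"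

definition mod2_cycles :: "nat \<Rightarrow> 'a topology \<Rightarrow> 'a mod2_chain set" where
  "mod2_cycles p X = {c \<in> carrier (mod2_chain_group p X). mod2_boundary p c = 0}"

definition mod2_boundaries :: "nat \<Rightarrow> 'a topology \<Rightarrow> 'a mod2_chain set" where
  "mod2_boundaries p X = mod2_boundary (Suc p) ` carrier (mod2_chain_group (Suc p) X)"

definition mod2_homology_group :: "nat \<Rightarrow> 'a topology \<Rightarrow> 'a mod2_chain set monoid" where
  "mod2_homology_group p X =
     (mod2_chain_group p X) \<lparr>carrier := mod2_cycles p X\<rparr> Mod mod2_boundaries p X"

definition mod2_chain_map :: "nat \<Rightarrow> ('a \<Rightarrow> 'b) \<Rightarrow> 'a mod2_chain \<Rightarrow> 'b mod2_chain" where
  "mod2_chain_map p f c =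
     (\<Sum>s\<in>Poly_Mapping.keys c. Poly_Mapping.single (simplex_map p f s) (Poly_Mapping.lookup c s))"

text \<open>The map induced in homology by \<open>f\<close> into \<open>Y\<close>: the class of a cycle \<open>c\<close> is sent to the coset
  of the image of \<open>c\<close>, obtained here by adding all boundaries of \<open>Y\<close> to the image of the class.\<close>

definition mod2_hom_induced ::
    "nat \<Rightarrow> 'b topology \<Rightarrow> ('a \<Rightarrow> 'b) \<Rightarrow> 'a mod2_chain set \<Rightarrow> 'b mod2_chain set" where
  "mod2_hom_induced p Y f K = mod2_chain_map p f ` K <#>\<^bsub>mod2_chain_group p Y\<^esub> mod2_boundaries p Y"


section \<open>Tightness\<close>

definition p_tight :: "nat \<Rightarrow> 'a topology \<Rightarrow> ('a \<Rightarrow> 'b::euclidean_space) \<Rightarrow> bool" where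
  "p_tight p X \<phi> \<longleftrightarrow> (\<forall>a b. a \<noteq> 0 \<longrightarrow>
     inj_on (mod2_hom_induced p (top_of_set (\<phi> ` topspace X)) id)
       (carrier (mod2_homology_group p (top_of_set (\<phi> ` topspace X \<inter> {x. a \<bullet> x < b})))))"

definition tight :: "'a topology \<Rightarrow> ('a \<Rightarrow> 'b::euclidean_space) \<Rightarrow> bool" where
  "tight X \<phi> \<longleftrightarrow> (\<forall>p. p_tight p X \<phi>)"

end

theory Submission
  imports Defs
begin

text \<open>Let \<open>P\<close> be the convex hull of the image, an \<open>n\<close>-dimensional polytope since the embedding is
  polyhedral and substantial. By 0-tightness every open half-space meets the image in a connected
  set, so the image contains the 1-skeleton of \<open>P\<close>. By 1-tightness the vertices of \<open>P\<close> come from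
  boundary points: a small loop around an interior point bounds a disc in the surface, but not in
  the complement of the point, because the boundary of the surface is nonempty. Finally the
  1-skeleton of an \<open>n\<close>-polytope contains a subdivision of the complete graph on \<open>n + 1\<close> vertices
  (Gruenbaum), which is thus properly embedded in the surface.\<close>

section \<open>Subdivided complete graphs in the 1-skeleton of a polytope\<close>

text \<open>That a loop does not bound in a punctured surface is certified by a map from it to the
  punctured plane along which the loop turns once: the parity of turns is a mod 2 cocycle, so it
  vanishes on boundaries. On a closed connected surface no such map exists, because of the mod 2
  fundamental class. It is written down only for a puncture next to the boundary, where the angle
  can be made constant before it reaches the rest of the surface. Homeomorphisms supported in charts
  carry the property to the other interior points. The spreading argument uses the closure of the
  set of good points, so that connectedness of the surface itself suffices and connectedness of its
  interior need not be established.

  The link with half-spaces is compactness: vertices of the hull are exposed, and a compact part of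
  the image that avoids one lies in an open half-space whose bounding hyperplane still cuts the
  vertex off.

  In the polytope part, branch vertices have to be extreme points for two reasons: only then do the
  segments from a new vertex run along edges, and only then are they sent to the boundary of the
  surface.\<close>

lemma exists_face_rel_interior:
  fixes P :: "'b::euclidean_space set"
  assumes "polyhedron P" "x \<in> P"
  obtains F where "F face_of P" "x \<in> rel_interior F"
proof -
  \<comment> \<open>The smallest face containing \<open>x\<close>. A point of it outside the
    relative interior would lie on a facet, which is a smaller face.\<close>
  define F where "F = \<Inter> {F. F face_of P \<and> x \<in> F}"
  have ne: "P \<in> {F. F face_of P \<and> x \<in> F}"
    using assms face_of_refl polyhedron_imp_convex by blast
  have F: "F face_of P"
    unfolding F_def using ne by (intro face_of_Inter) auto
  have x: "x \<in> F"
    unfolding F_def by auto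
  have "x \<in> rel_interior F"
  proof (rule ccontr)
    assume "x \<notin> rel_interior F"
    moreover have "polyhedron F"
      using F assms face_of_polyhedron_polyhedron by blast
    ultimately obtain G where "G facet_of F" "x \<in> G"
      using x rel_interior_of_polyhedron by blast
    then have "F \<subseteq> G"
      using F face_of_trans facet_of_imp_face_of unfolding F_def by blast
    then show False
      using \<open>G facet_of F\<close> facet_of_imp_subset facet_of_def by fastforce
  qed
  with F that show ?thesis by blast
qed

text \<open>A nonempty relatively open subset of an affine set spans that set, and \<open>x\<close>
  makes the trace of \<open>rel_interior F\<close> on the hyperplane nonempty. This lets the
  dimension of a slice be computed from affine hulls.\<close>

lemma slice_rel_interior:
  fixes F :: "'b::euclidean_space set"
  assumes "convex F" "x \<in> rel_interior F" "a \<bullet> x = c"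
  shows "x \<in> rel_interior (F \<inter> {y. a \<bullet> y = c})"
    and "affine hull (F \<inter> {y. a \<bullet> y = c}) = affine hull F \<inter> {y. a \<bullet> y = c}"
proof -
  let ?H = "{y. a \<bullet> y = c}"
  show "x \<in> rel_interior (F \<inter> ?H)"
    using convex_affine_rel_interior_Int[of F ?H] assms affine_hyperplane by blast
  have aff: "affine (affine hull F \<inter> ?H)"
    by (simp add: affine_Int affine_hyperplane)
  have "openin (top_of_set (affine hull F \<inter> ?H)) (rel_interior F \<inter> ?H)"
    using openin_rel_interior[of F] by (metis inf_commute openin_subtopology_Int_subset openin_Int_open
      openin_subtopology_Int subtopology_subtopology)
  then have "affine hull (rel_interior F \<inter> ?H) = affine hull F \<inter> ?H"
    using affine_hull_openin[of "affine hull F \<inter> ?H"] aff assms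
    by (metis (mono_tags, lifting) Int_iff affine_hull_eq empty_iff mem_Collect_eq)
  moreover have "affine hull (rel_interior F \<inter> ?H) \<subseteq> affine hull (F \<inter> ?H)"
    by (intro hull_mono) (use rel_interior_subset in blast)
  moreover have "affine hull (F \<inter> ?H) \<subseteq> affine hull F \<inter> ?H"
    by (metis aff hull_minimal hull_subset inf.mono order_refl)
  ultimately show "affine hull (F \<inter> ?H) = affine hull F \<inter> ?H" by simp
qed

lemma continuous_on_Max:
  fixes f :: "'i \<Rightarrow> 'a::topological_space \<Rightarrow> real"
  assumes "finite I" "I \<noteq> {}" "\<And>i. i \<in> I \<Longrightarrow> continuous_on S (f i)"
  shows "continuous_on S (\<lambda>x. MAX i\<in>I. f i x)"
  using assms by (induction rule: finite_ne_induct) (auto intro!: continuous_intros)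

text \<open>The improper face \<open>P\<close> counts too, so a point or a segment is its own
  1-skeleton; the induction on dimension starts from this.\<close>

definition face_skeleton :: "int \<Rightarrow> 'b::euclidean_space set \<Rightarrow> 'b set" where
  "face_skeleton k P = \<Union> {F. F face_of P \<and> aff_dim F \<le> k}"

lemma face_skeleton_subset: "face_skeleton k P \<subseteq> P"
  unfolding face_skeleton_def using face_of_imp_subset by fastforce

lemma face_skeleton_0: "x \<in> face_skeleton 0 P \<longleftrightarrow> x extreme_point_of P"
proof
  assume "x \<in> face_skeleton 0 P"
  then obtain F where F: "F face_of P" "aff_dim F \<le> 0" "x \<in> F"
    unfolding face_skeleton_def by blast
  then have "aff_dim F = 0"
    using aff_dim_negative_iff by (metis empty_iff linorder_not_less order_antisym)
  then have "F = {x}"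
    using F aff_dim_eq_0[of F] by (metis singletonD)
  with F show "x extreme_point_of P"
    using face_of_singleton by blast
qed (auto simp: face_skeleton_def simp flip: face_of_singleton intro!: exI[of _ "{x}"])

lemma polytope_separate_vertex:
  fixes P :: "'b::euclidean_space set"
  assumes "polytope P" "v extreme_point_of P"
  obtains a c where "c < a \<bullet> v" "\<And>w. w extreme_point_of P \<Longrightarrow> w \<noteq> v \<Longrightarrow> a \<bullet> w < c"
proof -
  have "{v} exposed_face_of P"
    using assms by (simp add: exposed_face_of_polyhedron polytope_imp_polyhedron face_of_singleton)
  then obtain a b where ab: "P \<subseteq> {x. a \<bullet> x \<le> b}" "{v} = P \<inter> {x. a \<bullet> x = b}"
    unfolding exposed_face_of_def by blast
  define W where "W = {w. w extreme_point_of P} - {v}"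
  have fin: "finite W"
    unfolding W_def using assms finite_polyhedron_extreme_points polytope_imp_polyhedron by blast
  have lt: "a \<bullet> w < b" if "w \<in> W" for w
    using that ab unfolding W_def extreme_point_of_def by fastforce
  have b: "a \<bullet> v = b" using ab by blast
  \<comment> \<open>The extra entry \<open>b - 1\<close> keeps the maximum meaningful when
    \<open>v\<close> is the only vertex.\<close>
  define m where "m = Max (insert (b - 1) ((\<lambda>w. a \<bullet> w) ` W))"
  have "m < b"
    unfolding m_def using fin lt by (subst Max_less_iff) auto
  moreover have "a \<bullet> w \<le> m" if "w \<in> W" for w
    unfolding m_def using fin that by (intro Max_ge) auto
  ultimately show ?thesis
    using b W_def by (intro that[of "(m + b) / 2" a]) (force simp: field_simps)+
qed

text \<open>The slice is the vertex figure at \<open>v\<close>, and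
  \<open>v + \<gamma> x *\<^sub>R (x - v)\<close> is the point where the ray from \<open>v\<close>
  through \<open>x\<close> leaves \<open>P\<close>. A face of the slice of dimension
  \<open>k\<close> comes from a face of \<open>P\<close> through \<open>v\<close> of dimension
  \<open>k + 1\<close>; the exit point lies in a proper face of that one, which brings the dimension
  back to \<open>k\<close>. For \<open>k = 0\<close> the face through \<open>v\<close> is an edge
  and contains the whole segment.\<close>

lemma polytope_vertex_figure:
  fixes P :: "'b::euclidean_space set"
  assumes P: "polytope P" and v: "v extreme_point_of P" and dim: "aff_dim P = int (Suc d)"
  obtains a c \<gamma> where "c < a \<bullet> v" "polytope (P \<inter> {x. a \<bullet> x = c})"
    "aff_dim (P \<inter> {x. a \<bullet> x = c}) = int d"
    "continuous_on (P \<inter> {x. a \<bullet> x = c}) \<gamma>"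
    "\<And>x. x \<in> P \<inter> {x. a \<bullet> x = c} \<Longrightarrow> 0 < \<gamma> x"
    "\<And>k x. x \<in> face_skeleton k (P \<inter> {x. a \<bullet> x = c}) \<Longrightarrow> v + \<gamma> x *\<^sub>R (x - v) \<in> face_skeleton k P"
    "\<And>x. x \<in> face_skeleton 0 (P \<inter> {x. a \<bullet> x = c}) \<Longrightarrow>
      closed_segment v (v + \<gamma> x *\<^sub>R (x - v)) \<subseteq> face_skeleton 1 P"
proof -
  obtain a c where av: "c < a \<bullet> v" and aw: "\<And>w. w extreme_point_of P \<Longrightarrow> w \<noteq> v \<Longrightarrow> a \<bullet> w < c"
    using polytope_separate_vertex[OF P v] by metis
  define H where "H = {x. a \<bullet> x = c}"
  have convP: "convex P" and bdP: "bounded P" and phP: "polyhedron P"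
    using P polytope_imp_convex polytope_imp_bounded polytope_imp_polyhedron by auto
  have vP: "v \<in> P" using v extreme_point_of_def by blast
  \<comment> \<open>A face without \<open>v\<close> has all its vertices strictly below the
    hyperplane, so it cannot reach it.\<close>
  have v_face: "v \<in> F" if F: "F face_of P" and x: "x \<in> F" "a \<bullet> x = c" for F x
  proof (rule ccontr)
    assume "v \<notin> F"
    have "F = convex hull {w. w extreme_point_of F}"
      using F P face_of_polytope_polytope polytope_imp_compact polytope_imp_convex Krein_Milman_Minkowski by blast
    moreover have "{w. w extreme_point_of F} \<subseteq> {x. a \<bullet> x < c}"
      using aw F \<open>v \<notin> F\<close> extreme_point_of_face by blast
    ultimately have "F \<subseteq> {x. a \<bullet> x < c}"
      by (metis convex_halfspace_lt hull_minimal)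
    with x show False by auto
  qed
  have phQ: "polytope (P \<inter> H)"
    unfolding H_def using P polytope_Int_polyhedron polyhedron_hyperplane by blast
  \<comment> \<open>Relative interior points close to \<open>v\<close> and close to another vertex
    lie on opposite sides of the hyperplane, so some relative interior point lies on it.\<close>
  obtain z where z: "z \<in> rel_interior P" "a \<bullet> z = c"
  proof -
    have cl: "P \<subseteq> closure (rel_interior P)"
      using convP closure_subset convex_closure_rel_interior by blast
    have "P \<noteq> {v}" using dim by auto
    moreover have "P = convex hull {w. w extreme_point_of P}"
      using Krein_Milman_Minkowski P polytope_imp_compact polytope_imp_convex by blast
    ultimately obtain w where w: "w extreme_point_of P" "w \<noteq> v"
    proof -
      have "\<exists>w. w extreme_point_of P \<and> w \<noteq> v"
      proof (rule ccontr)
        assume "\<not> ?thesis"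
        then have "{w. w extreme_point_of P} = {v}" using v by blast
        then show False
          using \<open>P \<noteq> {v}\<close> \<open>P = convex hull {w. w extreme_point_of P}\<close> by simp
      qed
      then show ?thesis by (elim exE conjE) (rule that)
    qed
    then have "w \<in> P" using extreme_point_of_def by blast
    have "open {x. c < a \<bullet> x}" "open {x. a \<bullet> x < c}"
      by (simp_all add: open_halfspace_gt open_halfspace_lt)
    with cl \<open>w \<in> P\<close> vP aw[OF w] av obtain x y
      where "x \<in> rel_interior P" "c < a \<bullet> x" "y \<in> rel_interior P" "a \<bullet> y < c"
      by (smt (verit) disjoint_iff mem_Collect_eq open_Int_closure_eq_empty subset_iff)
    then show ?thesis
      using connected_ivt_hyperplane[of "rel_interior P" y x a c] convP convex_rel_interior
        convex_connected that by (metis less_imp_le)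
  qed
  have dimQ: "aff_dim (P \<inter> H) = int d"
  proof -
    have "aff_dim (P \<inter> H) = aff_dim (affine hull P \<inter> H)"
      using slice_rel_interior(2)[OF convP z] H_def by (metis aff_dim_affine_hull)
    also have "\<dots> = aff_dim P - 1"
    proof -
      have "z \<in> affine hull P" "v \<in> affine hull P"
        using z vP hull_subset rel_interior_subset by (metis subsetD)+
      then show ?thesis
        unfolding H_def using z av by (subst aff_dim_affine_Int_hyperplane) auto
    qed
    finally show ?thesis using dim by simp
  qed
  \<comment> \<open>Take the face \<open>F\<close> of \<open>P\<close> with \<open>x\<close> in its
    relative interior. Then \<open>x\<close> is also relatively interior to
    \<open>F \<inter> H\<close>, so \<open>G\<close>, being a face, absorbs
    \<open>F \<inter> H\<close>; and slicing costs exactly one dimension because \<open>v\<close>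
    lies in \<open>F\<close> but not on the hyperplane.\<close>
  have minface: "\<exists>F. F face_of P \<and> x \<in> F \<and> v \<in> F \<and> aff_dim F \<le> k + 1"
    if x: "x \<in> face_skeleton k (P \<inter> H)" for k x
  proof -
    obtain G where G: "G face_of P \<inter> H" "aff_dim G \<le> k" "x \<in> G"
      using x unfolding face_skeleton_def by auto
    then have xP: "x \<in> P" "a \<bullet> x = c"
      using face_of_imp_subset H_def by auto
    obtain F where F: "F face_of P" "x \<in> rel_interior F"
      using exists_face_rel_interior[OF phP xP(1)] by blast
    have convF: "convex F" using F face_of_imp_convex by blast
    have xF: "x \<in> F" using F rel_interior_subset by blast
    have "v \<in> F" using v_face[OF F(1) xF xP(2)] .
    have "F \<inter> H \<subseteq> G"
      using subset_of_face_of[OF G(1), of "F \<inter> H"] slice_rel_interior(1)[OF convF F(2) xP(2)] F(1) G(3)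
      unfolding H_def using face_of_imp_subset by blast
    then have "aff_dim (F \<inter> H) \<le> k"
      using G(2) aff_dim_subset order_trans by blast
    moreover have "aff_dim (F \<inter> H) = aff_dim F - 1"
    proof -
      have "x \<in> affine hull F" "v \<in> affine hull F"
        using xF \<open>v \<in> F\<close> hull_subset by (metis subsetD)+
      then have "aff_dim (affine hull F \<inter> H) = aff_dim F - 1"
        unfolding H_def using xP av by (subst aff_dim_affine_Int_hyperplane) auto
      then show ?thesis
        using slice_rel_interior(2)[OF convF F(2) xP(2)] H_def by (metis aff_dim_affine_hull)
    qed
    ultimately show ?thesis using F(1) xF \<open>v \<in> F\<close> by force
  qed
  obtain \<H> where \<H>: "finite \<H>" "P = \<Inter>\<H>" "\<And>h. h \<in> \<H> \<Longrightarrow> \<exists>a b. h = {x. a \<bullet> x \<le> b}"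
    using phP unfolding polyhedron_def by metis
  then obtain A B where AB: "\<And>h. h \<in> \<H> \<Longrightarrow> h = {x. A h \<bullet> x \<le> B h}"
    by metis
  have memP: "x \<in> P \<longleftrightarrow> (\<forall>h\<in>\<H>. A h \<bullet> x \<le> B h)" for x
    using \<H>(2) AB by blast
  \<comment> \<open>The facet inequalities not active at \<open>v\<close> determine where a ray from \<open>v\<close> leaves \<open>P\<close>.\<close>
  define N where "N = {h \<in> \<H>. A h \<bullet> v < B h}"
  define q where "q h x = (A h \<bullet> (x - v)) / (B h - A h \<bullet> v)" for h x
  have finN: "finite N" using \<H>(1) N_def by simp
  have active: "A h \<bullet> v = B h" if "h \<in> \<H>" "h \<notin> N" for h
    using that vP memP unfolding N_def by force
  \<comment> \<open>If no inequality ever stopped the ray from \<open>v\<close> through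
    \<open>x\<close>, it would stay in the bounded set \<open>P\<close>.\<close>
  have exq: "\<exists>h\<in>N. 0 < q h x" if x: "x \<in> P \<inter> H" for x
  proof (rule ccontr)
    assume neg: "\<not> (\<exists>h\<in>N. 0 < q h x)"
    have "x \<noteq> v" using x av H_def by auto
    have le: "A h \<bullet> (x - v) \<le> 0" if "h \<in> \<H>" for h
    proof (cases "h \<in> N")
      case True
      then have "\<not> 0 < q h x" "0 < B h - A h \<bullet> v" using neg N_def by auto
      then show ?thesis unfolding q_def by (simp add: zero_less_divide_iff)
    next
      case False
      then show ?thesis
        using active[OF that] x memP that by (force simp: inner_diff_right)
    qed
    have ray: "v + t *\<^sub>R (x - v) \<in> P" if "0 \<le> t" for t
      unfolding memP
    proof
      fix h assume h: "h \<in> \<H>"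
      have "t * (A h \<bullet> (x - v)) \<le> 0" using le[OF h] that by (simp add: mult_nonneg_nonpos)
      moreover have "A h \<bullet> v \<le> B h" using vP memP h by blast
      ultimately show "A h \<bullet> (v + t *\<^sub>R (x - v)) \<le> B h"
        by (simp add: inner_add_right)
    qed
    obtain M where M: "\<And>y. y \<in> P \<Longrightarrow> norm (y - v) \<le> M"
      using bdP by (metis bounded_any_center dist_norm dist_commute)
    have "0 \<le> M" using M[OF vP] by simp
    define t where "t = (M + 1) / norm (x - v)"
    have "norm (v + t *\<^sub>R (x - v) - v) = M + 1"
      unfolding t_def using \<open>0 \<le> M\<close> \<open>x \<noteq> v\<close> by simp
    moreover have "0 \<le> t" unfolding t_def using \<open>0 \<le> M\<close> by simp
    ultimately show False using M[OF ray[of t]] by simp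
  qed
  have neN: "N \<noteq> {}"
  proof -
    have "P \<inter> H \<noteq> {}" using z rel_interior_subset H_def by blast
    then show ?thesis using exq by blast
  qed
  \<comment> \<open>A positive \<open>q h x\<close> is the reciprocal of the parameter at which the
    ray meets the hyperplane of \<open>h\<close>, so the maximum is the reciprocal of the exit
    parameter. Working with reciprocals avoids dividing by values of \<open>q\<close> that vanish or
    are negative.\<close>
  define \<delta> where "\<delta> x = (MAX h\<in>N. q h x)" for x
  have \<delta>pos: "0 < \<delta> x" if "x \<in> P \<inter> H" for x
    using exq[OF that] finN neN unfolding \<delta>_def by (subst Max_gr_iff) auto
  have \<delta>ge: "q h x \<le> \<delta> x" if "h \<in> N" for h x
    unfolding \<delta>_def using finN that by (intro Max_ge) auto
  have \<delta>ex: "\<exists>h\<in>N. q h x = \<delta> x" for x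
  proof -
    have "Max ((\<lambda>h. q h x) ` N) \<in> (\<lambda>h. q h x) ` N"
      using finN neN by (intro Max_in) auto
    then show ?thesis unfolding \<delta>_def by force
  qed
  define \<gamma> where "\<gamma> x = inverse (\<delta> x)" for x
  have \<gamma>pos: "0 < \<gamma> x" if "x \<in> P \<inter> H" for x
    using \<delta>pos[OF that] \<gamma>_def by simp
  have cont: "continuous_on (P \<inter> H) \<gamma>"
    unfolding \<gamma>_def
  proof (rule continuous_on_inverse)
    show "continuous_on (P \<inter> H) \<delta>"
      unfolding \<delta>_def
    proof (rule continuous_on_Max[OF finN neN])
      fix h assume "h \<in> N"
      then show "continuous_on (P \<inter> H) (q h)"
        unfolding q_def by (intro continuous_intros) (auto simp: N_def)
    qed
  qed (use \<delta>pos in force)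
  define \<rho> where "\<rho> x = v + \<gamma> x *\<^sub>R (x - v)" for x
  have \<rho>P: "\<rho> x \<in> P" if x: "x \<in> P \<inter> H" for x
    unfolding memP
  proof
    fix h assume h: "h \<in> \<H>"
    show "A h \<bullet> \<rho> x \<le> B h"
    proof (cases "h \<in> N")
      case True
      then have "0 < B h - A h \<bullet> v" using N_def by auto
      have "q h x * \<gamma> x \<le> 1"
        using \<delta>ge[OF True, of x] \<delta>pos[OF x] unfolding \<gamma>_def by (simp add: pos_divide_le_eq flip: divide_inverse)
      then have "\<gamma> x * (A h \<bullet> (x - v)) \<le> B h - A h \<bullet> v"
        using \<open>0 < B h - A h \<bullet> v\<close> unfolding q_def by (simp add: field_simps)
      then show ?thesis unfolding \<rho>_def by (simp add: inner_add_right)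
    next
      case False
      have "A h \<bullet> (x - v) \<le> 0"
        using active[OF h False] x memP h by (force simp: inner_diff_right)
      then have "\<gamma> x * (A h \<bullet> (x - v)) \<le> 0"
        using \<gamma>pos[OF x] by (simp add: mult_nonneg_nonpos)
      then show ?thesis unfolding \<rho>_def using active[OF h False] by (simp add: inner_add_right)
    qed
  qed
  \<comment> \<open>If \<open>\<rho> x\<close> lies beyond \<open>x\<close>, then \<open>x\<close>
    is inside the segment from \<open>v\<close> to \<open>\<rho> x\<close> and the face property
    yields the end point; otherwise \<open>\<rho> x\<close> lies between \<open>v\<close> and
    \<open>x\<close> and convexity does.\<close>
  have \<rho>F: "\<rho> x \<in> F" if x: "x \<in> P \<inter> H" and F: "F face_of P" "x \<in> F" "v \<in> F" for x F
  proof (cases "1 < \<gamma> x")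
    case True
    have "x \<noteq> v" using x av H_def by auto
    have "x = (1 - inverse (\<gamma> x)) *\<^sub>R v + inverse (\<gamma> x) *\<^sub>R \<rho> x"
      unfolding \<rho>_def using True by (simp add: algebra_simps)
    moreover have "v \<noteq> \<rho> x" unfolding \<rho>_def using True \<open>x \<noteq> v\<close> by auto
    ultimately have "x \<in> open_segment v (\<rho> x)"
      unfolding in_segment using True by (intro conjI exI[of _ "inverse (\<gamma> x)"]) (auto simp: inverse_less_1_iff)
    then show ?thesis
      using F vP \<rho>P[OF x] unfolding face_of_def by blast
  next
    case False
    have "\<rho> x = (1 - \<gamma> x) *\<^sub>R v + \<gamma> x *\<^sub>R x" unfolding \<rho>_def by (simp add: algebra_simps)
    moreover have "convex F" using F face_of_imp_convex by blast
    ultimately show ?thesis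
      using convexD[of F v x "1 - \<gamma> x" "\<gamma> x"] F False \<gamma>pos[OF x] by auto
  qed
  have sub: "face_skeleton k (P \<inter> H) \<subseteq> P \<inter> H" for k
    by (rule face_skeleton_subset)
  have \<rho>_skel: "\<rho> x \<in> face_skeleton k P" if x: "x \<in> face_skeleton k (P \<inter> H)" for x k
  proof -
    obtain F where F: "F face_of P" "x \<in> F" "v \<in> F" "aff_dim F \<le> k + 1"
      using minface[OF x] by blast
    have xQ: "x \<in> P \<inter> H" using x sub by blast
    \<comment> \<open>The inequality attaining the maximum becomes an equality at
      \<open>\<rho> x\<close> but is strict at \<open>v\<close>, so it cuts a proper face out of
      \<open>F\<close>.\<close>
    obtain h where h: "h \<in> N" "q h x = \<delta> x" using \<delta>ex by blast
    then have hv: "A h \<bullet> v < B h" "h \<in> \<H>" using N_def by auto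
    have "\<gamma> x * q h x = 1" using h \<delta>pos[OF xQ] \<gamma>_def by simp
    then have \<rho>h: "A h \<bullet> \<rho> x = B h"
      unfolding \<rho>_def q_def inner_add_right inner_scaleR_right using hv by (simp add: field_simps)
    have "F \<inter> {y. A h \<bullet> y = B h} face_of F"
      using F face_of_imp_subset hv memP
      by (intro face_of_Int_supporting_hyperplane_le face_of_imp_convex[OF F(1)]) blast
    moreover have "F \<inter> {y. A h \<bullet> y = B h} \<noteq> F" using F(3) hv(1) by (metis (mono_tags) IntD2 less_irrefl mem_Collect_eq)
    ultimately have "aff_dim (F \<inter> {y. A h \<bullet> y = B h}) < aff_dim F" "F \<inter> {y. A h \<bullet> y = B h} face_of P"
      using face_of_aff_dim_lt[OF face_of_imp_convex[OF F(1)]] face_of_trans[OF _ F(1)] by simp_all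
    then show ?thesis
      unfolding face_skeleton_def using F(4) \<rho>h \<rho>F[OF xQ F(1-3)]
      by (auto intro!: exI[of _ "F \<inter> {y. A h \<bullet> y = B h}"])
  qed
  have seg: "closed_segment v (\<rho> x) \<subseteq> face_skeleton 1 P" if x: "x \<in> face_skeleton 0 (P \<inter> H)" for x
  proof -
    obtain F where F: "F face_of P" "x \<in> F" "v \<in> F" "aff_dim F \<le> 0 + 1"
      using minface[OF x] by blast
    then have "closed_segment v (\<rho> x) \<subseteq> F"
      using \<rho>F[of x F] x sub face_of_imp_convex closed_segment_subset by blast
    then show ?thesis
      unfolding face_skeleton_def using F by auto
  qed
  show ?thesis
    by (rule that[of c a \<gamma>, folded H_def, OF av phQ dimQ cont \<gamma>pos \<rho>_skel[unfolded \<rho>_def] seg[unfolded \<rho>_def]])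
qed

section \<open>The complete graph in barycentric coordinates\<close>

definition edge_point :: "nat \<Rightarrow> nat \<Rightarrow> real \<Rightarrow> nat \<Rightarrow> real" where
  "edge_point i k t = (\<lambda>m. (1 - t) * vertex_point i m + t * vertex_point k m)"

text \<open>Pairs with \<open>i = k\<close> are allowed: their degenerate edges are the vertices, so
  that \<open>d = 0\<close> gives a single point rather than the empty set. As a finite union of
  arcs the set is visibly compact; \<open>graph_realization_complete\<close> matches it with the
  official realization.\<close>

definition complete_realization :: "nat \<Rightarrow> (nat \<Rightarrow> real) set" where
  "complete_realization d = (\<Union>i\<in>{..d}. \<Union>k\<in>{..d}. edge_point i k ` {0..1})"

lemma edge_point_simps [simp]: "edge_point i k 0 = vertex_point i" "edge_point i k 1 = vertex_point k"
  "edge_point i i t = vertex_point i"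
  by (auto simp: edge_point_def vertex_point_def fun_eq_iff)

lemma edge_point_swap: "edge_point k i t = edge_point i k (1 - t)"
  by (auto simp: edge_point_def)

lemma mem_complete_realization:
  "x \<in> complete_realization d \<longleftrightarrow> (\<exists>i k t. i \<le> d \<and> k \<le> d \<and> 0 \<le> t \<and> t \<le> 1 \<and> x = edge_point i k t)"
  unfolding complete_realization_def UN_iff image_iff Bex_def atMost_iff atLeastAtMost_iff by metis

lemma vertex_point_in_complete_realization: "i \<le> d \<Longrightarrow> vertex_point i \<in> complete_realization d"
  unfolding mem_complete_realization by (metis edge_point_simps(3) order_refl zero_le_one)

lemma continuous_on_coordinate: "continuous_on S (\<lambda>x::'i \<Rightarrow> 'c::topological_space. x i)"
  by (rule continuous_on_subset[OF continuous_on_product_coordinates]) simp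

lemma continuous_on_edge_point: "continuous_on A (edge_point i k)"
  unfolding edge_point_def
  by (intro continuous_on_coordinatewise_then_product continuous_intros)

lemma compact_edge: "compact (edge_point i k ` {0..1})"
  by (intro compact_continuous_image continuous_on_edge_point) auto

lemma compact_complete_realization: "compact (complete_realization d)"
  unfolding complete_realization_def by (intro compact_UN compact_edge) auto

lemma complete_realization_Suc:
  "complete_realization (Suc d) =
    complete_realization d \<union> (\<Union>i\<le>d. edge_point i (Suc d) ` {0..1})" (is "?L = ?R")
proof
  have R: "x \<in> ?R \<longleftrightarrow> x \<in> complete_realization d \<or>
      (\<exists>i t. i \<le> d \<and> 0 \<le> t \<and> t \<le> 1 \<and> x = edge_point i (Suc d) t)" for x
    unfolding Un_iff UN_iff image_iff Bex_def atMost_iff atLeastAtMost_iff by metis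
  show "?R \<subseteq> ?L"
  proof
    fix x assume "x \<in> ?R"
    then show "x \<in> ?L" unfolding R unfolding mem_complete_realization by (metis le_SucI order_refl)
  qed
  show "?L \<subseteq> ?R"
  proof
    fix x assume "x \<in> ?L"
    then obtain i k t where x: "i \<le> Suc d" "k \<le> Suc d" "0 \<le> t" "t \<le> 1" "x = edge_point i k t"
      unfolding mem_complete_realization by auto
    consider "i \<le> d" "k \<le> d" | "i \<le> d" "k = Suc d" | "i = Suc d" "k \<le> d" | "i = Suc d" "k = Suc d"
      using x by linarith
    then show "x \<in> ?R"
    proof cases
      case 1
      then show ?thesis unfolding R mem_complete_realization using x by blast
    next
      case 2
      then show ?thesis unfolding R using x by blast
    next
      case 3
      then have "x = edge_point k (Suc d) (1 - t)" using x edge_point_swap by simp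
      moreover have "0 \<le> 1 - t" "1 - t \<le> 1" using x by auto
      ultimately show ?thesis unfolding R using 3 by blast
    next
      case 4
      then have "x = edge_point 0 (Suc d) 1" using x by simp
      then show ?thesis unfolding R by (metis le0 order_refl zero_le_one)
    qed
  qed
qed

lemma complete_realization_zero: "x \<in> complete_realization d \<Longrightarrow> d < k \<Longrightarrow> x k = 0"
  by (auto simp: complete_realization_def edge_point_def vertex_point_def)

text \<open>Induction on the dimension: a graph in the vertex figure at \<open>v\<close> is pushed
  along rays to where they leave \<open>P\<close>, and \<open>v\<close> becomes the new branch
  vertex, joined to the old ones by straight segments. The pieces do not cross, since a point other
  than \<open>v\<close> determines its ray from \<open>v\<close>, and distinct points of the vertex
  figure span distinct rays.\<close>

lemma polytope_complete_graph:
  fixes P :: "'b::euclidean_space set"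
  assumes "polytope P" "aff_dim P = int d"
  shows "\<exists>g. continuous_on (complete_realization d) g \<and> inj_on g (complete_realization d) \<and>
    g ` complete_realization d \<subseteq> face_skeleton 1 P \<and>
    (\<forall>i\<le>d. g (vertex_point i) extreme_point_of P)"
  using assms
proof (induction d arbitrary: P)
  case 0
  then obtain p where p: "P = {p}" using aff_dim_eq_0[of P] by auto
  have "complete_realization 0 = {vertex_point 0}"
  proof
    show "complete_realization 0 \<subseteq> {vertex_point 0}"
      unfolding subset_iff mem_complete_realization by auto
  qed (auto intro: vertex_point_in_complete_realization)
  moreover have "p \<in> face_skeleton 1 P"
    unfolding face_skeleton_def using p by (auto intro!: exI[of _ "{p}"] face_of_refl)
  ultimately show ?case
    using p by (intro exI[of _ "\<lambda>_. p"]) auto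
next
  case (Suc d)
  have "P \<noteq> {}" using Suc.prems by force
  then obtain v where v: "v extreme_point_of P"
    using Suc.prems(1) extreme_point_exists_convex polytope_imp_compact polytope_imp_convex by blast
  obtain a c \<gamma> where av: "c < a \<bullet> v" and Q: "polytope (P \<inter> {x. a \<bullet> x = c})"
    "aff_dim (P \<inter> {x. a \<bullet> x = c}) = int d"
    and cont: "continuous_on (P \<inter> {x. a \<bullet> x = c}) \<gamma>"
    and pos: "\<And>x. x \<in> P \<inter> {x. a \<bullet> x = c} \<Longrightarrow> 0 < \<gamma> x"
    and skel: "\<And>k x. x \<in> face_skeleton k (P \<inter> {x. a \<bullet> x = c}) \<Longrightarrow> v + \<gamma> x *\<^sub>R (x - v) \<in> face_skeleton k P"
    and seg: "\<And>x. x \<in> face_skeleton 0 (P \<inter> {x. a \<bullet> x = c}) \<Longrightarrow>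
      closed_segment v (v + \<gamma> x *\<^sub>R (x - v)) \<subseteq> face_skeleton 1 P"
    by (rule polytope_vertex_figure[OF Suc.prems(1) v Suc.prems(2)]) (rule that)
  define Q where "Q = P \<inter> {x. a \<bullet> x = c}"
  obtain g where gc: "continuous_on (complete_realization d) g"
    and gi: "inj_on g (complete_realization d)"
    and g1: "g ` complete_realization d \<subseteq> face_skeleton 1 Q"
    and g0: "\<And>i. i \<le> d \<Longrightarrow> g (vertex_point i) extreme_point_of Q"
    using Suc.IH[OF Q] unfolding Q_def by blast
  have gQ: "g x \<in> Q" if "x \<in> complete_realization d" for x
    using g1 that face_skeleton_subset by blast
  have g0': "g (vertex_point i) \<in> face_skeleton 0 Q" if "i \<le> d" for i
    using g0[OF that] face_skeleton_0 by blast
  define D where "D = (\<Union>i\<le>d. edge_point i (Suc d) ` {0..1})"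
  define \<rho> where "\<rho> x = v + \<gamma> x *\<^sub>R (x - v)" for x
  \<comment> \<open>The cone from \<open>v\<close> over the graph already embedded in the vertex figure.\<close>
  define r where "r x = v + (\<Sum>i\<le>d. x i *\<^sub>R (\<rho> (g (vertex_point i)) - v))" for x :: "nat \<Rightarrow> real"
  define g' where "g' x = (if x \<in> complete_realization d then \<rho> (g x) else r x)" for x
  have r_edge: "r (edge_point i (Suc d) t) = v + ((1 - t) * \<gamma> (g (vertex_point i))) *\<^sub>R (g (vertex_point i) - v)"
    if "i \<le> d" for i t
  proof -
    have "edge_point i (Suc d) t j = (if j = i then 1 - t else 0)" if "j \<le> d" for j
      using that by (auto simp: edge_point_def vertex_point_def)
    then have "(\<Sum>j\<le>d. edge_point i (Suc d) t j *\<^sub>R (\<rho> (g (vertex_point j)) - v)) =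
        (\<Sum>j\<le>d. if j = i then (1 - t) *\<^sub>R (\<rho> (g (vertex_point j)) - v) else 0)"
      by (intro sum.cong) auto
    then show ?thesis
      unfolding r_def using that by (simp add: \<rho>_def)
  qed
  have overlap: "\<rho> (g x) = r x" if x: "x \<in> complete_realization d" "x \<in> D" for x
  proof -
    obtain i t where it: "i \<le> d" "x = edge_point i (Suc d) t"
      using x(2) unfolding D_def by auto
    have "x (Suc d) = 0" using x(1) complete_realization_zero by blast
    then have "t = 0" using it by (simp add: edge_point_def vertex_point_def)
    then show ?thesis using it r_edge[OF it(1), of t] by (simp add: \<rho>_def)
  qed
  have Suc_eq: "complete_realization (Suc d) = complete_realization d \<union> D"
    unfolding D_def by (rule complete_realization_Suc)
  have "continuous_on (complete_realization (Suc d)) g'"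
    unfolding Suc_eq g'_def
  proof (rule continuous_on_If)
    show "closed (complete_realization d)"
      using compact_complete_realization compact_imp_closed by blast
    show "closed D"
      unfolding D_def by (intro compact_imp_closed compact_UN compact_edge) auto
    have "continuous_on (complete_realization d) (\<lambda>x. \<gamma> (g x))"
      by (rule continuous_on_compose2[OF cont gc]) (use gQ in \<open>auto simp: Q_def\<close>)
    then show "continuous_on (complete_realization d) (\<lambda>x. \<rho> (g x))"
      unfolding \<rho>_def using gc by (intro continuous_intros)
    show "continuous_on D r"
      unfolding r_def by (intro continuous_intros continuous_on_coordinate)
    show "\<rho> (g x) = r x" if "x \<in> D" "x \<in> complete_realization d" for x
      using overlap that by blast
  qed auto
  moreover have "inj_on g' (complete_realization (Suc d))"
  proof -
    \<comment> \<open>The hyperplane coordinate of a point on a ray from \<open>v\<close> recovers its position on that ray.\<close>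
    have ray_inj: "s = t \<and> (s \<noteq> 0 \<longrightarrow> x = y)"
      if eq: "v + s *\<^sub>R (x - v) = v + t *\<^sub>R (y - v)" and xy: "x \<in> Q" "y \<in> Q" for s t x y
    proof -
      have *: "s *\<^sub>R (x - v) = t *\<^sub>R (y - v)" using eq by simp
      then have "s * (a \<bullet> (x - v)) = t * (a \<bullet> (y - v))"
        by (metis inner_scaleR_right)
      then have "s * (c - a \<bullet> v) = t * (c - a \<bullet> v)"
        using xy unfolding Q_def by (simp add: inner_diff_right)
      then have "s = t" using av by simp
      then show ?thesis using * by auto
    qed
    \<comment> \<open>Polar coordinates from \<open>v\<close>: \<open>q\<close> is the point of the
      ray in the vertex figure and \<open>s\<close> the scaling. Excluding \<open>t = 0\<close> in
      the second alternative makes its scaling strictly smaller than \<open>\<gamma> q\<close>,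
      which tells it apart from the first.\<close>
    have coord: "\<exists>s q. g' x = v + s *\<^sub>R (q - v) \<and> q \<in> Q \<and>
        (x \<in> complete_realization d \<and> q = g x \<and> s = \<gamma> q \<or>
        (\<exists>i\<le>d. \<exists>t. x = edge_point i (Suc d) t \<and> 0 < t \<and> t \<le> 1 \<and> q = g (vertex_point i) \<and> s = (1 - t) * \<gamma> q))"
      if x: "x \<in> complete_realization (Suc d)" for x
    proof (cases "x \<in> complete_realization d")
      case True
      then show ?thesis using gQ by (auto simp: g'_def \<rho>_def)
    next
      case False
      then obtain i t where it: "i \<le> d" "x = edge_point i (Suc d) t" "0 \<le> t" "t \<le> 1"
        using x unfolding Suc_eq D_def by auto
      have "t \<noteq> 0" using it False vertex_point_in_complete_realization by auto
      moreover have "g' x = v + ((1 - t) * \<gamma> (g (vertex_point i))) *\<^sub>R (g (vertex_point i) - v)"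
        unfolding g'_def using False it r_edge by simp
      moreover have "g (vertex_point i) \<in> Q"
        using gQ it vertex_point_in_complete_realization by blast
      ultimately show ?thesis using it
        by (intro exI[of _ "(1 - t) * \<gamma> (g (vertex_point i))"] exI[of _ "g (vertex_point i)"]) force
    qed
    have vd: "vertex_point i \<in> complete_realization d" if "i \<le> d" for i
      using that by (rule vertex_point_in_complete_realization)
    have \<gamma>pos: "0 < \<gamma> q" if "q \<in> Q" for q using pos that Q_def by blast
    show ?thesis
    proof (rule inj_onI)
      fix x y assume x: "x \<in> complete_realization (Suc d)" and y: "y \<in> complete_realization (Suc d)"
        and eq: "g' x = g' y"
      obtain s q where s: "g' x = v + s *\<^sub>R (q - v)" "q \<in> Q" and
        sx: "x \<in> complete_realization d \<and> q = g x \<and> s = \<gamma> q \<or>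
        (\<exists>i\<le>d. \<exists>t. x = edge_point i (Suc d) t \<and> 0 < t \<and> t \<le> 1 \<and> q = g (vertex_point i) \<and> s = (1 - t) * \<gamma> q)"
        using coord[OF x] by metis
      obtain s' q' where s': "g' y = v + s' *\<^sub>R (q' - v)" "q' \<in> Q" and
        sy: "y \<in> complete_realization d \<and> q' = g y \<and> s' = \<gamma> q' \<or>
        (\<exists>i\<le>d. \<exists>t. y = edge_point i (Suc d) t \<and> 0 < t \<and> t \<le> 1 \<and> q' = g (vertex_point i) \<and> s' = (1 - t) * \<gamma> q')"
        using coord[OF y] by metis
      have ss: "s = s'" and qq: "s \<noteq> 0 \<Longrightarrow> q = q'"
        using ray_inj[of s q s' q'] s s' eq by auto
      have gpos: "0 < \<gamma> q" using \<gamma>pos s by blast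
      show "x = y"
      proof (cases "s = 0")
        case True
        \<comment> \<open>Scaling 0 is impossible in the first alternative, as
          \<open>\<gamma>\<close> is positive, and forces \<open>t = 1\<close> in the second. Every
          edge ends at the same new vertex, written here as the end of the edge from 0.\<close>
        have one: "z = edge_point 0 (Suc d) 1"
          if "z \<in> complete_realization d \<and> p = g z \<and> 0 = \<gamma> p \<or>
            (\<exists>i\<le>d. \<exists>t. z = edge_point i (Suc d) t \<and> 0 < t \<and> t \<le> 1 \<and> p = g (vertex_point i) \<and> 0 = (1 - t) * \<gamma> p)"
            "p \<in> Q" for z p
          using that(1) \<gamma>pos[OF that(2)] by auto
        show ?thesis
          using one[of x q] one[of y q'] sx sy ss True s(2) s'(2) by simp
      next
        case False
        then have q: "q' = q" using qq by simp
        have lt: "(1 - t) * \<gamma> q \<noteq> \<gamma> q" if "0 < t" for t using that gpos by auto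
        from sx sy consider
          (1) "x \<in> complete_realization d" "y \<in> complete_realization d" "g x = g y"
          | (2) i t j u where "i \<le> d" "x = edge_point i (Suc d) t" "j \<le> d" "y = edge_point j (Suc d) u"
            "g (vertex_point i) = g (vertex_point j)" "(1 - t) * \<gamma> q = (1 - u) * \<gamma> q"
          using lt ss q by metis
        then show ?thesis
        proof cases
          case 1
          then show ?thesis using gi inj_onD by metis
        next
          case 2
          then have "(vertex_point i :: nat \<Rightarrow> real) = vertex_point j"
            using gi vd by (metis inj_onD)
          then have "i = j" by (metis vertex_point_def zero_neq_one)
          moreover have "t = u" using 2 gpos by simp
          ultimately show ?thesis using 2 by simp
        qed
      qed
    qed
  qed
  moreover have "g' ` complete_realization (Suc d) \<subseteq> face_skeleton 1 P"
  proof -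
    have "\<rho> (g x) \<in> face_skeleton 1 P" if "x \<in> complete_realization d" for x
      using skel g1 that unfolding \<rho>_def Q_def by blast
    moreover have "r (edge_point i (Suc d) t) \<in> face_skeleton 1 P" if "i \<le> d" "0 \<le> t" "t \<le> 1" for i t
    proof -
      have "r (edge_point i (Suc d) t) = t *\<^sub>R v + (1 - t) *\<^sub>R \<rho> (g (vertex_point i))"
        unfolding r_edge[OF that(1)] \<rho>_def by (simp add: algebra_simps)
      then have "r (edge_point i (Suc d) t) \<in> closed_segment v (\<rho> (g (vertex_point i)))"
        unfolding in_segment using that by (intro exI[of _ "1 - t"]) auto
      then show ?thesis
        using seg[of "g (vertex_point i)"] g0'[OF that(1)] unfolding \<rho>_def Q_def by blast
    qed
    ultimately show ?thesis
      unfolding Suc_eq D_def g'_def by auto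
  qed
  moreover have "g' (vertex_point i) extreme_point_of P" if i: "i \<le> Suc d" for i
  proof (cases "i \<le> d")
    case True
    then show ?thesis
      using skel[of _ 0] g0' vertex_point_in_complete_realization[OF True]
      unfolding g'_def \<rho>_def Q_def face_skeleton_0 by simp
  next
    case False
    then have i: "i = Suc d" using i by simp
    have "vertex_point (Suc d) \<notin> complete_realization d"
      using complete_realization_zero[of "vertex_point (Suc d)" d "Suc d"] by (auto simp: vertex_point_def)
    then have "g' (vertex_point i) = v"
      unfolding g'_def using r_edge[of 0 1] i by simp
    then show ?thesis using v by simp
  qed
  ultimately show ?case by blast
qed

section \<open>Consequences of tightness for mod 2 chains\<close>

text \<open>Both sums can be taken over the union of the supports, because \<open>h s 0 = 0\<close>.
  The boundary and the evaluation of a cochain are both instances.\<close>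

lemma sum_keys_add:
  fixes h :: "'k \<Rightarrow> 'b::monoid_add \<Rightarrow> 'c::comm_monoid_add"
  assumes "\<And>s. h s 0 = 0" "\<And>s a b. h s (a + b) = h s a + h s b"
  shows "(\<Sum>s\<in>Poly_Mapping.keys (c + d). h s (Poly_Mapping.lookup (c + d) s)) =
    (\<Sum>s\<in>Poly_Mapping.keys c. h s (Poly_Mapping.lookup c s)) +
    (\<Sum>s\<in>Poly_Mapping.keys d. h s (Poly_Mapping.lookup d s))"
proof -
  let ?K = "Poly_Mapping.keys c \<union> Poly_Mapping.keys d"
  have ext: "(\<Sum>s\<in>Poly_Mapping.keys e. h s (Poly_Mapping.lookup e s)) = (\<Sum>s\<in>?K. h s (Poly_Mapping.lookup e s))"
    if "Poly_Mapping.keys e \<subseteq> ?K" for e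
    using that assms(1) by (intro sum.mono_neutral_left) (auto simp: in_keys_iff)
  show ?thesis
    unfolding ext[OF Poly_Mapping.keys_add] ext[OF Un_upper1] ext[OF Un_upper2]
    by (simp only: lookup_add assms(2) sum.distrib)
qed

lemma sum_keys_single:
  assumes "h s 0 = 0"
  shows "(\<Sum>t\<in>Poly_Mapping.keys (Poly_Mapping.single s b). h t (Poly_Mapping.lookup (Poly_Mapping.single s b) t)) = h s b"
  using assms by (cases "b = 0") auto

lemma mod2_boundary_add: "mod2_boundary p (c + d) = mod2_boundary p c + mod2_boundary p d"
proof (cases "p = 0")
  case False
  then show ?thesis
    unfolding mod2_boundary_def if_not_P[OF False]
    by (intro sum_keys_add) (simp_all only: single_add sum.distrib single_zero sum.neutral_const)
qed (simp add: mod2_boundary_def)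

lemma mod2_boundary_single:
  "0 < p \<Longrightarrow> mod2_boundary p (Poly_Mapping.single s b) =
    (\<Sum>k\<le>p. Poly_Mapping.single (singular_face p k s) b)"
  unfolding mod2_boundary_def
  using sum_keys_single[of "\<lambda>s b. \<Sum>k\<le>p. Poly_Mapping.single (singular_face p k s) b" s b]
  by simp

lemma carrier_mod2_chain_group [simp]:
  "c \<in> carrier (mod2_chain_group p X) \<longleftrightarrow> Poly_Mapping.keys c \<subseteq> singular_simplex_set p X"
  by (simp add: mod2_chain_group_def)

lemma zero_mod2_boundaries: "0 \<in> mod2_boundaries p X"
  unfolding mod2_boundaries_def by (auto intro!: image_eqI[of _ _ 0] simp: mod2_boundary_def)

lemma mod2_boundaries_add:
  assumes "c \<in> mod2_boundaries p X" "d \<in> mod2_boundaries p X"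
  shows "c + d \<in> mod2_boundaries p X"
proof -
  obtain a b where ab: "c = mod2_boundary (Suc p) a" "d = mod2_boundary (Suc p) b"
    "Poly_Mapping.keys a \<subseteq> singular_simplex_set (Suc p) X"
    "Poly_Mapping.keys b \<subseteq> singular_simplex_set (Suc p) X"
    using assms unfolding mod2_boundaries_def by auto
  then have "Poly_Mapping.keys (a + b) \<subseteq> singular_simplex_set (Suc p) X"
    using Poly_Mapping.keys_add[of a b] by blast
  then show ?thesis
    unfolding mod2_boundaries_def using ab mod2_boundary_add[of "Suc p" a b]
    by (intro image_eqI[of _ _ "a + b"]) auto
qed

lemma mod2_boundary_carrier:
  assumes "c \<in> carrier (mod2_chain_group (Suc p) X)"
  shows "mod2_boundary (Suc p) c \<in> carrier (mod2_chain_group p X)"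
proof -
  have faces: "Poly_Mapping.keys (\<Sum>k\<le>Suc p. Poly_Mapping.single (singular_face (Suc p) k s) (Poly_Mapping.lookup c s))
      \<subseteq> (\<Union>k\<in>{..Suc p}. {singular_face (Suc p) k s})" for s
    by (rule order_trans[OF keys_sum]) (intro UN_mono order_refl, simp)
  have "Poly_Mapping.keys (mod2_boundary (Suc p) c) \<subseteq>
      (\<Union>s\<in>Poly_Mapping.keys c. \<Union>k\<in>{..Suc p}. {singular_face (Suc p) k s})"
    unfolding mod2_boundary_def if_not_P[OF nat.distinct(2)]
    by (rule order_trans[OF keys_sum UN_mono[OF order_refl faces]])
  then show ?thesis
    using assms singular_simplex_singular_face[of "Suc p" X] by fastforce
qed

lemma mod2_boundaries_mono:
  assumes "A \<subseteq> B"
  shows "mod2_boundaries p (top_of_set A) \<subseteq> mod2_boundaries p (top_of_set B)"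
  unfolding mod2_boundaries_def using singular_simplex_mono[OF _ assms, of _ euclidean]
  by (intro image_mono subsetI) (auto dest!: subsetD)

lemma mod2_chain_map_id:
  assumes "c \<in> carrier (mod2_chain_group p X)"
  shows "mod2_chain_map p id c = c"
proof -
  have "simplex_map p id s = s" if "s \<in> Poly_Mapping.keys c" for s
    using that assms by (intro simplex_map_id_gen[where X = X]) auto
  then have "mod2_chain_map p id c =
      (\<Sum>s\<in>Poly_Mapping.keys c. Poly_Mapping.single s (Poly_Mapping.lookup c s))"
    unfolding mod2_chain_map_def by (intro sum.cong) auto
  also have "\<dots> = c"
    by (rule poly_mapping_eqI) (simp add: lookup_sum lookup_single when_def in_keys_iff)
  finally show ?thesis .
qed

lemma bit_chain_add_self: "c + c = (0 :: 'k \<Rightarrow>\<^sub>0 bit)"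
  by (rule poly_mapping_eqI) (simp add: lookup_add)

text \<open>Boundaries in \<open>A\<close> are boundaries in \<open>B\<close>, and \<open>c\<close>
  is its own negative, so the class of a chain that bounds in \<open>B\<close> goes to the zero
  class. Taking \<open>c = 0\<close> as well gives two classes with the same image.\<close>

lemma mod2_hom_induced_coset:
  assumes "A \<subseteq> B" and c: "c \<in> carrier (mod2_chain_group p (top_of_set A))"
    "c \<in> mod2_boundaries p (top_of_set B)"
  shows "mod2_hom_induced p (top_of_set B) id
      ((\<lambda>h. h + c) ` mod2_boundaries p (top_of_set A)) = mod2_boundaries p (top_of_set B)"
proof -
  let ?BA = "mod2_boundaries p (top_of_set A)" and ?BB = "mod2_boundaries p (top_of_set B)"
  have id: "mod2_chain_map p id (h + c) = h + c" if "h \<in> ?BA" for h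
  proof -
    have "h \<in> carrier (mod2_chain_group p (top_of_set A))"
      using that mod2_boundary_carrier unfolding mod2_boundaries_def by blast
    then have "h + c \<in> carrier (mod2_chain_group p (top_of_set A))"
      using c Poly_Mapping.keys_add[of h c] by auto
    then show ?thesis by (rule mod2_chain_map_id)
  qed
  have "mod2_hom_induced p (top_of_set B) id ((\<lambda>h. h + c) ` ?BA) = (\<Union>h\<in>?BA. \<Union>k\<in>?BB. {h + c + k})"
    unfolding mod2_hom_induced_def set_mult_def by (simp add: mod2_chain_group_def id)
  also have "\<dots> = ?BB"
  proof
    show "(\<Union>h\<in>?BA. \<Union>k\<in>?BB. {h + c + k}) \<subseteq> ?BB"
      using subsetD[OF mod2_boundaries_mono[OF \<open>A \<subseteq> B\<close>]] c(2) by (auto intro!: mod2_boundaries_add)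
    show "?BB \<subseteq> (\<Union>h\<in>?BA. \<Union>k\<in>?BB. {h + c + k})"
    proof
      fix k assume k: "k \<in> ?BB"
      have "0 + c + (c + k) = k" by (simp add: bit_chain_add_self flip: add.assoc)
      then show "k \<in> (\<Union>h\<in>?BA. \<Union>k\<in>?BB. {h + c + k})"
        using zero_mod2_boundaries mod2_boundaries_add[OF c(2) k] by force
    qed
  qed
  finally show ?thesis .
qed

text \<open>Tightness at the level of chains. The cosets of \<open>c\<close> and of 0 have the same
  image, so injectivity makes them equal, and \<open>c\<close> lies in the coset of 0.\<close>

lemma p_tightD:
  fixes \<phi> :: "'a \<Rightarrow> 'b::euclidean_space"
  assumes "p_tight p X \<phi>" "a \<noteq> 0"
    and c: "c \<in> carrier (mod2_chain_group p (top_of_set (\<phi> ` topspace X \<inter> {x. a \<bullet> x < b})))"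
    "mod2_boundary p c = 0" "c \<in> mod2_boundaries p (top_of_set (\<phi> ` topspace X))"
  shows "c \<in> mod2_boundaries p (top_of_set (\<phi> ` topspace X \<inter> {x. a \<bullet> x < b}))"
proof -
  let ?A = "\<phi> ` topspace X \<inter> {x. a \<bullet> x < b}" and ?B = "\<phi> ` topspace X"
  let ?H = "mod2_boundaries p (top_of_set ?A)"
  have coset: "(\<lambda>h. h + d) ` ?H \<in> carrier (mod2_homology_group p (top_of_set ?A))"
    if "d \<in> mod2_cycles p (top_of_set ?A)" for d
    unfolding mod2_homology_group_def FactGroup_def RCOSETS_def r_coset_def
    using that by (auto simp: mod2_chain_group_def)
  have "c \<in> mod2_cycles p (top_of_set ?A)" "0 \<in> mod2_cycles p (top_of_set ?A)"
    using c unfolding mod2_cycles_def by (auto simp: mod2_boundary_def)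
  moreover have "mod2_hom_induced p (top_of_set ?B) id ((\<lambda>h. h + c) ` ?H) =
      mod2_hom_induced p (top_of_set ?B) id ((\<lambda>h. h + 0) ` ?H)"
    using c zero_mod2_boundaries by (subst (1 2) mod2_hom_induced_coset) auto
  ultimately have "(\<lambda>h. h + c) ` ?H = (\<lambda>h. h + 0) ` ?H"
    using assms(1,2) coset unfolding p_tight_def by (meson inj_onD)
  moreover have "0 + c \<in> (\<lambda>h. h + c) ` ?H"
    using zero_mod2_boundaries by (intro imageI)
  ultimately show ?thesis by simp
qed

section \<open>Mod 2 cochains\<close>

definition mod2_eval :: "(((nat \<Rightarrow> real) \<Rightarrow> 'a) \<Rightarrow> bit) \<Rightarrow> 'a mod2_chain \<Rightarrow> bit" where
  "mod2_eval w c = (\<Sum>s\<in>Poly_Mapping.keys c. Poly_Mapping.lookup c s * w s)"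

lemma mod2_eval_add: "mod2_eval w (c + d) = mod2_eval w c + mod2_eval w d"
  unfolding mod2_eval_def by (intro sum_keys_add) (simp_all only: distrib_right mult_zero_left)

lemma mod2_eval_single: "mod2_eval w (Poly_Mapping.single s b) = b * w s"
  unfolding mod2_eval_def using sum_keys_single[of "\<lambda>s b. b * w s" s b] by simp

lemma mod2_eval_sum: "mod2_eval w (sum f I) = (\<Sum>i\<in>I. mod2_eval w (f i))"
proof -
  have 0: "mod2_eval w 0 = 0" by (simp add: mod2_eval_def)
  show ?thesis
    by (induction I rule: infinite_finite_induct)
      (simp_all only: 0 mod2_eval_add sum.infinite sum.empty sum.insert not_False_eq_True)
qed

text \<open>Evaluating on a boundary means evaluating the coboundary of \<open>w\<close>, by
  exchanging two finite sums. All proofs that a cycle does not bound go through this: an explicit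
  cocycle takes the value 1 on the cycle.\<close>

lemma mod2_eval_boundary:
  assumes c: "c \<in> mod2_boundaries p X"
    and cocycle: "\<And>t. singular_simplex (Suc p) X t \<Longrightarrow> (\<Sum>k\<le>Suc p. w (singular_face (Suc p) k t)) = 0"
  shows "mod2_eval w c = 0"
proof -
  obtain d where d: "c = mod2_boundary (Suc p) d" "Poly_Mapping.keys d \<subseteq> singular_simplex_set (Suc p) X"
    using c unfolding mod2_boundaries_def by auto
  have "mod2_eval w c =
      (\<Sum>s\<in>Poly_Mapping.keys d. \<Sum>k\<le>Suc p. Poly_Mapping.lookup d s * w (singular_face (Suc p) k s))"
    unfolding d(1) mod2_boundary_def by (simp only: mod2_eval_sum mod2_eval_single if_False nat.distinct)
  also have "\<dots> = (\<Sum>s\<in>Poly_Mapping.keys d. Poly_Mapping.lookup d s * (\<Sum>k\<le>Suc p. w (singular_face (Suc p) k s)))"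
    by (simp only: sum_distrib_left)
  also have "\<dots> = 0"
    using cocycle d(2) by (intro sum.neutral) auto
  finally show ?thesis .
qed

section \<open>Singular simplices of dimension at most two\<close>

lemma singular_simplex_top_of_set:
  "singular_simplex p (top_of_set K) s \<longleftrightarrow>
    continuous_on (standard_simplex p) s \<and> s ` standard_simplex p \<subseteq> K \<and> s \<in> extensional (standard_simplex p)"
  for K :: "'b::topological_space set"
  unfolding singular_simplex_def by (auto simp: euclidean_product_topology continuous_map_in_subtopology)

lemma singular_simplex_restrict:
  "singular_simplex p (top_of_set K) (restrict f (standard_simplex p)) \<longleftrightarrow>
    continuous_on (standard_simplex p) f \<and> f ` standard_simplex p \<subseteq> K"
  for K :: "'b::topological_space set"
  unfolding singular_simplex_top_of_set by (auto cong: continuous_on_cong)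

lemma singular_face_eqI:
  assumes "0 < p" "k \<le> p" "\<And>u. u \<in> standard_simplex (p - 1) \<Longrightarrow> f (simplical_face k u) = g u"
  shows "singular_face p k (restrict f (standard_simplex p)) = restrict g (standard_simplex (p - 1))"
  using assms by (simp only: singular_face_restrict) (auto simp: singular_face_def intro!: restrict_ext)

text \<open>One notation for points of the standard simplices of dimensions 0, 1 and 2: in the lower
  dimensions the last coordinates are zero.\<close>

definition simplex2 :: "real \<Rightarrow> real \<Rightarrow> real \<Rightarrow> nat \<Rightarrow> real" where
  "simplex2 x y z = (\<lambda>i. if i = 0 then x else if i = 1 then y else if i = 2 then z else 0)"

lemma simplex2_apply [simp]: "simplex2 x y z 0 = x" "simplex2 x y z 1 = y" "simplex2 x y z (Suc 0) = y" "simplex2 x y z 2 = z"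
  by (auto simp: simplex2_def)

lemma standard_simplex_1: "standard_simplex 1 = (\<lambda>t. simplex2 (1 - t) t 0) ` {0..1}"
proof
  show "standard_simplex 1 \<subseteq> (\<lambda>t. simplex2 (1 - t) t 0) ` {0..1}"
  proof
    fix x assume x: "x \<in> standard_simplex 1"
    then have "x 0 + x 1 = 1" "\<forall>i>1. x i = 0" "0 \<le> x 1" "x 1 \<le> 1"
      by (auto simp: standard_simplex_def)
    then have "x = simplex2 (1 - x 1) (x 1) 0"
      by (auto simp: simplex2_def fun_eq_iff)
    then show "x \<in> (\<lambda>t. simplex2 (1 - t) t 0) ` {0..1}"
      using \<open>0 \<le> x 1\<close> \<open>x 1 \<le> 1\<close> by (intro image_eqI[of _ _ "x 1"]) auto
  qed
qed (auto simp: standard_simplex_def simplex2_def)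

lemma simplex2_in: "0 \<le> x \<Longrightarrow> 0 \<le> y \<Longrightarrow> 0 \<le> z \<Longrightarrow> x + y + z = 1 \<Longrightarrow> simplex2 x y z \<in> standard_simplex 2"
  by (auto simp: standard_simplex_def simplex2_def numeral_2_eq_2)

lemma simplical_face_simplex2:
  "simplical_face 0 (simplex2 x y 0) = simplex2 0 x y"
  "simplical_face (Suc 0) (simplex2 x y 0) = simplex2 x 0 y"
  "simplical_face 2 (simplex2 x y 0) = simplex2 x y 0"
  by (auto simp: simplical_face_def simplex2_def fun_eq_iff)

lemma continuous_on_simplex2:
  assumes "continuous_on S f" "continuous_on S g" "continuous_on S h"
  shows "continuous_on S (\<lambda>x. simplex2 (f x) (g x) (h x))"
proof (rule continuous_on_coordinatewise_then_product)
  show "continuous_on S (\<lambda>x. simplex2 (f x) (g x) (h x) i)" for i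
    using assms by (cases "i = 0"; cases "i = 1"; cases "i = 2") (simp_all add: simplex2_def)
qed

lemma simplex2_vertex: "(\<lambda>j. if j = 0 then 1 else 0) = simplex2 1 0 0"
  by (auto simp: simplex2_def)

lemma standard_simplex_0': "standard_simplex 0 = {simplex2 1 0 0}"
  by (simp add: standard_simplex_0 simplex2_vertex)

text \<open>If the half-space cut the image into two clopen parts, a point in each would give a
  0-cycle that bounds in the image, along a path, but not in the half-space, where the indicator of
  one part is a cocycle.\<close>

lemma zero_tight_connected:
  fixes \<phi> :: "'a \<Rightarrow> 'b::euclidean_space"
  assumes tight: "p_tight 0 X \<phi>" and "a \<noteq> 0" and pc: "path_connected (\<phi> ` topspace X)"
  shows "connected (\<phi> ` topspace X \<inter> {x. a \<bullet> x < b})"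
proof (rule ccontr)
  let ?K = "\<phi> ` topspace X"
  let ?E = "?K \<inter> {x. a \<bullet> x < b}"
  assume "\<not> connected ?E"
  then obtain A where A: "openin (top_of_set ?E) A" "closedin (top_of_set ?E) A" "A \<noteq> {}" "A \<noteq> ?E"
    unfolding connected_clopen by metis
  have AE: "A \<subseteq> ?E" using A(1) openin_imp_subset by blast
  obtain x y where x: "x \<in> A" and y: "y \<in> ?E" "y \<notin> A"
    using A AE by blast
  have xE: "x \<in> ?E" using x AE by blast
  define pt where "pt z = restrict (\<lambda>_. z) (standard_simplex 0)" for z :: 'b
  define c where "c = Poly_Mapping.single (pt x) 1 + Poly_Mapping.single (pt y) (1::bit)"
  have pt: "singular_simplex 0 (top_of_set S) (pt z) \<longleftrightarrow> z \<in> S" for z S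
    unfolding pt_def singular_simplex_restrict by (auto simp: standard_simplex_0)
  have "c \<in> carrier (mod2_chain_group 0 (top_of_set ?E))"
    using Poly_Mapping.keys_add[of "Poly_Mapping.single (pt x) 1" "Poly_Mapping.single (pt y) (1::bit)"]
      pt xE y by (auto simp: c_def)
  moreover have "mod2_boundary 0 c = 0" by (simp add: mod2_boundary_def)
  moreover have "c \<in> mod2_boundaries 0 (top_of_set ?K)"
  proof -
    obtain g where g: "path g" "path_image g \<subseteq> ?K" "pathstart g = x" "pathfinish g = y"
      using pc xE y(1) unfolding path_connected_def by blast
    define \<tau> where "\<tau> = restrict (\<lambda>u. g (u 1)) (standard_simplex 1)"
    have u: "u 1 \<in> {0..1}" if "u \<in> standard_simplex 1" for u
      using that by (auto simp: standard_simplex_def)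
    have "continuous_on (standard_simplex 1) (\<lambda>u. u 1)"
      by (rule continuous_on_subset[OF continuous_on_product_coordinates]) simp
    then have "continuous_on (standard_simplex 1) (\<lambda>u. g (u 1))"
      by (rule continuous_on_compose2[OF g(1)[unfolded path_def]]) (rule image_subsetI, rule u)
    moreover have "(\<lambda>u. g (u 1)) ` standard_simplex 1 \<subseteq> ?K"
    proof (rule image_subsetI)
      fix s assume "s \<in> standard_simplex 1"
      then have "g (s 1) \<in> g ` {0..1}" using u by (intro imageI)
      then show "g (s 1) \<in> ?K" using g(2) unfolding path_image_def by (rule rev_subsetD)
    qed
    ultimately have \<tau>: "singular_simplex 1 (top_of_set ?K) \<tau>"
      unfolding \<tau>_def singular_simplex_restrict by (rule conjI)
    have "singular_face 1 0 \<tau> = restrict (\<lambda>_. y) (standard_simplex (1 - 1))"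
      "singular_face 1 1 \<tau> = restrict (\<lambda>_. x) (standard_simplex (1 - 1))"
      unfolding \<tau>_def using g(3,4)
      by (intro singular_face_eqI; simp add: standard_simplex_0' simplical_face_simplex2 pathstart_def pathfinish_def)+
    then have "mod2_boundary 1 (Poly_Mapping.single \<tau> 1) = c"
      by (simp add: mod2_boundary_single c_def pt_def add.commute)
    then show ?thesis
      unfolding mod2_boundaries_def using \<tau>
      by (intro image_eqI[of _ _ "Poly_Mapping.single \<tau> 1"]) auto
  qed
  ultimately have cE: "c \<in> mod2_boundaries 0 (top_of_set ?E)"
    using p_tightD[OF tight \<open>a \<noteq> 0\<close>] by blast
  \<comment> \<open>\<open>simplex2 1 0 0\<close> is the only point of the standard 0-simplex. A
    1-simplex has connected image, so both its ends are in \<open>A\<close> or neither is, and the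
    two values cancel mod 2.\<close>
  define w :: "((nat \<Rightarrow> real) \<Rightarrow> 'b) \<Rightarrow> bit" where "w s = of_bool (s (simplex2 1 0 0) \<in> A)" for s
  have "mod2_eval w c = 0"
  proof (rule mod2_eval_boundary[OF cE])
    fix t assume t: "singular_simplex (Suc 0) (top_of_set ?E) t"
    define q where "q r = t (simplex2 (1 - r) r 0)" for r :: real
    have "continuous_on {0..1} q"
      unfolding q_def
    proof (rule continuous_on_compose2[of "standard_simplex 1" t])
      show "continuous_on (standard_simplex 1) t"
        using t unfolding singular_simplex_top_of_set by simp
      show "continuous_on {0..1} (\<lambda>r::real. simplex2 (1 - r) r 0)"
        by (intro continuous_on_simplex2 continuous_intros)
      show "(\<lambda>r. simplex2 (1 - r) r 0) ` {0..1} \<subseteq> standard_simplex 1"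
        by (simp add: standard_simplex_1 flip: One_nat_def)
    qed
    then have "connected (q ` {0..1})"
      by (intro connected_continuous_image) auto
    moreover have qE: "q ` {0..1} \<subseteq> ?E"
    proof -
      have "q ` {0..1} = t ` standard_simplex 1"
        unfolding q_def standard_simplex_1 image_image ..
      then show ?thesis
        using t unfolding singular_simplex_top_of_set by simp
    qed
    have "?E \<inter> A = A" using AE by (rule Int_absorb1)
    then have oc: "openin (top_of_set ?E) (?E \<inter> A)" "closedin (top_of_set ?E) (?E \<inter> A)"
      using A(1,2) by (simp_all only:)
    have "openin (top_of_set (q ` {0..1})) (q ` {0..1} \<inter> A)"
      by (rule openin_subtopology_Int_subset[OF oc(1) qE])
    moreover have "closedin (top_of_set (q ` {0..1})) (q ` {0..1} \<inter> A)"
      by (rule closedin_subtopology_Int_subset[OF oc(2) qE])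
    ultimately have "q ` {0..1} \<inter> A = {} \<or> q ` {0..1} \<inter> A = q ` {0..1}"
      unfolding connected_clopen by blast
    moreover have "q 0 \<in> q ` {0..1}" "q 1 \<in> q ` {0..1}" by auto
    ultimately have "q 0 \<in> A \<longleftrightarrow> q 1 \<in> A" by blast
    moreover have "w (singular_face (Suc 0) 0 t) = of_bool (q 1 \<in> A)"
      "w (singular_face (Suc 0) (Suc 0) t) = of_bool (q 0 \<in> A)"
      unfolding w_def singular_face_def q_def by (simp_all add: standard_simplex_0' simplical_face_simplex2)
    ultimately show "(\<Sum>k\<le>Suc 0. w (singular_face (Suc 0) k t)) = 0" by simp
  qed
  moreover have "mod2_eval w c = 1"
    unfolding c_def using x y by (simp add: mod2_eval_add mod2_eval_single w_def pt_def standard_simplex_0')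
  ultimately show False by simp
qed

section \<open>Loops in the punctured plane\<close>

text \<open>Two logarithms of the same function differ by a continuous function with values in the
  integer multiples of \<open>2 * pi * \<i>\<close>; distinct values are at least
  \<open>2 * pi\<close> apart, so it is constant on a connected set.\<close>

lemma lift_difference_constant:
  fixes L M :: "'x::topological_space \<Rightarrow> complex"
  assumes "connected S" "continuous_on S L" "continuous_on S M"
    and "\<And>t. t \<in> S \<Longrightarrow> exp (L t) = exp (M t)" and "a \<in> S" "b \<in> S"
  shows "L b - L a = M b - M a"
proof -
  define D where "D t = L t - M t" for t
  have D: "\<exists>n::int. D t = of_int (2 * n) * pi * \<i>" if "t \<in> S" for t
    using assms(4)[OF that] unfolding exp_eq D_def by (metis add_diff_cancel_left')
  have "D constant_on S"
  proof (rule continuous_discrete_range_constant[OF assms(1)])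
    show "continuous_on S D" unfolding D_def using assms by (intro continuous_intros)
    show "\<exists>e>0. \<forall>y. y \<in> S \<and> D y \<noteq> D x \<longrightarrow> e \<le> norm (D y - D x)" if x: "x \<in> S" for x
    proof (intro exI[of _ "2 * pi"] conjI allI impI)
      fix y assume y: "y \<in> S \<and> D y \<noteq> D x"
      obtain m n :: int where mn: "D y = of_int (2 * m) * pi * \<i>" "D x = of_int (2 * n) * pi * \<i>"
        using D x y by metis
      then have "m \<noteq> n" using y by auto
      then have "1 \<le> \<bar>m - n\<bar>" by linarith
      then have "1 \<le> \<bar>real_of_int (m - n)\<bar>" by linarith
      moreover have "D y - D x = of_real (2 * pi * real_of_int (m - n)) * \<i>"
        unfolding mn by (simp add: algebra_simps)
      then have "norm (D y - D x) = 2 * pi * \<bar>real_of_int (m - n)\<bar>"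
        by (simp add: norm_mult abs_mult del: of_int_diff)
      ultimately show "2 * pi \<le> norm (D y - D x)" by simp
    qed simp
  qed
  then have "D a = D b" using assms(5,6) by (metis constant_on_def)
  then show ?thesis unfolding D_def by (simp add: algebra_simps)
qed

text \<open>The number of turns made by a path \<open>h\<close> in the punctured plane, corrected at both ends by the
  principal logarithm so that it is an integer. The correction telescopes around a triangle.\<close>

definition turns :: "(real \<Rightarrow> complex) \<Rightarrow> int \<Rightarrow> bool" where
  "turns h n \<longleftrightarrow> (\<exists>L. continuous_on {0..1} L \<and> (\<forall>t\<in>{0..1}. h t = exp (L t)) \<and>
     L 1 - L 0 = Ln (h 1) - Ln (h 0) + of_int (2 * n) * pi * \<i>)"

lemma turns_unique:
  assumes "turns h m" "turns h n"
  shows "m = n"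
proof -
  obtain L M where L: "continuous_on {0..1} L" "\<And>t. t \<in> {0..1} \<Longrightarrow> h t = exp (L t)"
      "L 1 - L 0 = Ln (h 1) - Ln (h 0) + of_int (2 * m) * pi * \<i>"
    and M: "continuous_on {0..1} M" "\<And>t. t \<in> {0..1} \<Longrightarrow> h t = exp (M t)"
      "M 1 - M 0 = Ln (h 1) - Ln (h 0) + of_int (2 * n) * pi * \<i>"
    using assms unfolding turns_def by metis
  have "L 1 - L 0 = M 1 - M 0"
    using L M by (intro lift_difference_constant[of "{0..1}"]) auto
  then have "of_int (2 * m) * pi * \<i> = of_int (2 * n) * pi * \<i>" using L(3) M(3) by simp
  then show ?thesis by simp
qed

text \<open>Total in \<open>h\<close>: a path without a continuous logarithm gets parity 0, so this
  can serve as a cochain on arbitrary functions.\<close>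

definition turn_parity :: "(real \<Rightarrow> complex) \<Rightarrow> bit" where
  "turn_parity h = of_bool (\<exists>n. odd n \<and> turns h n)"

lemma turn_parity_eq: "turns h n \<Longrightarrow> turn_parity h = of_bool (odd n)"
  unfolding turn_parity_def using turns_unique[of h] by (intro arg_cong[of _ _ of_bool]) blast

lemma turn_parity_cong:
  assumes "\<And>t. t \<in> {0..1} \<Longrightarrow> h t = h' t"
  shows "turn_parity h = turn_parity h'"
proof -
  have "h 0 = h' 0" "h 1 = h' 1" using assms by auto
  then have "turns h n \<longleftrightarrow> turns h' n" for n
    unfolding turns_def using assms by simp
  then show ?thesis unfolding turn_parity_def by simp
qed

text \<open>This is the cocycle condition. A logarithm of \<open>h\<close> exists on all of
  \<open>T\<close> and differs from the principal one at \<open>z\<close> by an integer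
  \<open>n z\<close> of full turns. A side from \<open>p\<close> to \<open>q\<close> then turns
  \<open>n q - n p\<close> times, and the three numbers add up to \<open>2 * (n c - n a)\<close>. No
  continuity of \<open>n\<close> is involved.\<close>

lemma turn_parity_triangle:
  fixes h :: "complex \<Rightarrow> complex"
  assumes "continuous_on T h" "convex T" "\<And>z. z \<in> T \<Longrightarrow> h z \<noteq> 0"
    and abc: "a \<in> T" "b \<in> T" "c \<in> T"
  shows "turn_parity (h \<circ> linepath b c) + turn_parity (h \<circ> linepath a c) + turn_parity (h \<circ> linepath a b) = 0"
proof -
  obtain L where L: "continuous_on T L" "\<And>z. z \<in> T \<Longrightarrow> h z = exp (L z)"
    using continuous_logarithm_on_contractible[OF assms(1) convex_imp_contractible[OF assms(2)] assms(3)] by blast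
  have "\<exists>n. L z - Ln (h z) = of_int (2 * n) * pi * \<i>" if z: "z \<in> T" for z
  proof -
    have "exp (L z) = exp (Ln (h z))" using L assms(3) z by simp
    then obtain n :: int where "L z = Ln (h z) + of_int (2 * n) * pi * \<i>" unfolding exp_eq by blast
    then show ?thesis by (intro exI[of _ n]) simp
  qed
  then obtain n where n: "\<And>z. z \<in> T \<Longrightarrow> L z - Ln (h z) = of_int (2 * n z) * pi * \<i>" by metis
  have t: "turns (h \<circ> linepath p q) (n q - n p)" if pq: "p \<in> T" "q \<in> T" for p q
    unfolding turns_def
  proof (intro exI[of _ "L \<circ> linepath p q"] conjI ballI)
    have sub: "linepath p q ` {0..1} \<subseteq> T"
      using closed_segment_subset[OF pq assms(2)] by (metis path_image_def path_image_linepath)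
    then show "continuous_on {0..1} (L \<circ> linepath p q)"
      using L(1) by (intro continuous_on_compose continuous_on_linepath) (rule continuous_on_subset)
    show "(h \<circ> linepath p q) t = exp ((L \<circ> linepath p q) t)" if "t \<in> {0..1}" for t
      unfolding o_def by (rule L(2)) (use sub that in blast)
    show "(L \<circ> linepath p q) 1 - (L \<circ> linepath p q) 0 =
        Ln ((h \<circ> linepath p q) 1) - Ln ((h \<circ> linepath p q) 0) + of_int (2 * (n q - n p)) * pi * \<i>"
      using n[OF pq(1)] n[OF pq(2)] by (simp add: linepath_0' linepath_1' algebra_simps)
  qed
  show ?thesis
    using t[OF abc(2,3)] t[OF abc(1,3)] t[OF abc(1,2)] by (auto simp: turn_parity_eq)
qed

text \<open>On the quotient \<open>h z / z\<close> the principal logarithm is continuous. Adding the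
  angle of \<open>z\<close> gives a logarithm along the loop; the quotient part returns to its
  initial value and the angle grows by one full turn.\<close>

lemma turn_parity_circle:
  assumes cont: "continuous_on (sphere 0 1) h" and h: "\<And>z. z \<in> sphere 0 1 \<Longrightarrow> h z / z \<notin> \<real>\<^sub>\<le>\<^sub>0"
  shows "turn_parity (\<lambda>t. h (cis (2 * pi * t))) = 1"
proof -
  define L where "L t = \<i> * of_real (2 * pi * t) + Ln (h (cis (2 * pi * t)) / cis (2 * pi * t))" for t :: real
  have nz: "h (cis (2 * pi * t)) / cis (2 * pi * t) \<notin> \<real>\<^sub>\<le>\<^sub>0" for t
    using h[of "cis (2 * pi * t)"] by simp
  have ne: "h (cis (2 * pi * t)) \<noteq> 0" for t
  proof
    assume "h (cis (2 * pi * t)) = 0"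
    with nz[of t] show False by simp
  qed
  have "turns (\<lambda>t. h (cis (2 * pi * t))) 1"
    unfolding turns_def
  proof (intro exI[of _ L] conjI ballI)
    have cis: "continuous_on {0..1} (\<lambda>t. cis (2 * pi * t))" by (intro continuous_intros)
    have "continuous_on {0..1} (\<lambda>t. h (cis (2 * pi * t)))"
      by (rule continuous_on_compose2[OF cont cis]) auto
    then show "continuous_on {0..1} L"
      unfolding L_def using nz by (intro continuous_intros cis) auto
    show "h (cis (2 * pi * t)) = exp (L t)" for t
      unfolding L_def using ne[of t] by (simp add: exp_add cis_conv_exp mult.commute)
    show "L 1 - L 0 = Ln (h (cis (2 * pi * 1))) - Ln (h (cis (2 * pi * 0))) + of_int (2 * 1) * pi * \<i>"
      unfolding L_def by simp
  qed
  then show ?thesis by (simp add: turn_parity_eq)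
qed

text \<open>Coning off the loop gives a 2-simplex whose two remaining faces coincide, so they cancel mod 2.\<close>

definition loop_simplex :: "(complex \<Rightarrow> 'b) \<Rightarrow> (nat \<Rightarrow> real) \<Rightarrow> 'b" where
  "loop_simplex J = restrict (\<lambda>u. J (cis (2 * pi * u 1))) (standard_simplex 1)"

lemma singular_simplex_loop_simplex:
  assumes "continuous_on (sphere 0 1) J" "J ` sphere 0 1 \<subseteq> K"
  shows "singular_simplex 1 (top_of_set K) (loop_simplex J)"
  unfolding loop_simplex_def singular_simplex_restrict
proof
  show "continuous_on (standard_simplex 1) (\<lambda>u. J (cis (2 * pi * u 1)))"
    by (rule continuous_on_compose2[OF assms(1)]) (auto intro!: continuous_intros continuous_on_coordinate)
qed (use assms in auto)

lemma mod2_boundary_loop_simplex: "mod2_boundary 1 (Poly_Mapping.single (loop_simplex J) 1) = 0"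
proof -
  have "singular_face 1 0 (loop_simplex J) = restrict (\<lambda>_. J 1) (standard_simplex (1 - 1))"
    "singular_face 1 1 (loop_simplex J) = restrict (\<lambda>_. J 1) (standard_simplex (1 - 1))"
    unfolding loop_simplex_def
    by (intro singular_face_eqI; simp add: standard_simplex_0' simplical_face_simplex2)+
  then show ?thesis
    by (simp add: mod2_boundary_single bit_chain_add_self)
qed

lemma loop_simplex_boundary:
  fixes K :: "'b::topological_space set"
  assumes J: "continuous_on (cball 0 1) J" "J ` cball 0 1 \<subseteq> K"
  shows "Poly_Mapping.single (loop_simplex J) 1 \<in> mod2_boundaries 1 (top_of_set K)"
proof -
  \<comment> \<open>Polar coordinates on the triangle: \<open>u 1 + u 2\<close> is the radius and
    the ratio is the fraction of a turn. Vertex 0 goes to the centre, the opposite side to the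
    circle, and the other two sides to the same radius. At the centre the ratio is
    \<open>0 / 0\<close>, but the radius 0 makes its value irrelevant, also for continuity.\<close>
  define k where "k u = of_real (u 1 + u 2) * cis (2 * pi * (u 2 / (u 1 + u 2)))" for u :: "nat \<Rightarrow> real"
  define \<kappa> where "\<kappa> = restrict (\<lambda>u. J (k u)) (standard_simplex 2)"
  have u: "0 \<le> u 1 + u 2 \<and> u 1 + u 2 \<le> 1" if "u \<in> standard_simplex 2" for u
  proof -
    have "0 \<le> u 0" "0 \<le> u 1" "0 \<le> u 2" "u 0 + u 1 + u 2 = 1"
      using that by (auto simp: standard_simplex_def numeral_2_eq_2)
    then show ?thesis by linarith
  qed
  have norm_k: "norm (k u) = \<bar>u 1 + u 2\<bar>" for u
    unfolding k_def by (simp add: norm_mult flip: of_real_add)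
  have "continuous_on (standard_simplex 2) k"
    unfolding continuous_on_def
  proof
    fix u assume "u \<in> standard_simplex 2"
    have coord: "((\<lambda>x. x i) \<longlongrightarrow> u i) (at u within standard_simplex 2)" for i
      using continuous_on_coordinate[of UNIV i] tendsto_within_subset
      by (metis UNIV_I continuous_on_def subset_UNIV)
    show "(k \<longlongrightarrow> k u) (at u within standard_simplex 2)"
    proof (cases "u 1 + u 2 = 0")
      case False
      then show ?thesis
        unfolding k_def by (intro tendsto_intros coord)
    next
      case True
      have "((\<lambda>x. \<bar>x 1 + x 2\<bar>) \<longlongrightarrow> \<bar>u 1 + u 2\<bar>) (at u within standard_simplex 2)"
        by (intro tendsto_intros coord)
      then have "(k \<longlongrightarrow> 0) (at u within standard_simplex 2)"
        unfolding True by (intro Lim_null_comparison[of k]) (auto simp: norm_k)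
      then show ?thesis using True by (simp add: k_def)
    qed
  qed
  moreover have k: "k ` standard_simplex 2 \<subseteq> cball 0 1"
    using u by (auto simp: norm_k)
  ultimately have "continuous_on (standard_simplex 2) (\<lambda>u. J (k u))"
    by (intro continuous_on_compose2[OF J(1)])
  moreover have "(\<lambda>u. J (k u)) ` standard_simplex 2 \<subseteq> K"
    using J(2) k by blast
  ultimately have \<kappa>: "singular_simplex 2 (top_of_set K) \<kappa>"
    unfolding \<kappa>_def singular_simplex_restrict by (rule conjI)
  have eqs: "k (simplical_face 0 v) = cis (2 * pi * v 1)"
    "k (simplical_face 1 v) = of_real (v 1)" "k (simplical_face 2 v) = of_real (v 1)"
    if "v \<in> standard_simplex (2 - 1)" for v
  proof -
    have "v \<in> standard_simplex 1" using \<open>v \<in> _\<close> by simp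
    then obtain t where "v = simplex2 (1 - t) t 0" unfolding standard_simplex_1 by blast
    then show "k (simplical_face 0 v) = cis (2 * pi * v 1)"
      "k (simplical_face 1 v) = of_real (v 1)" "k (simplical_face 2 v) = of_real (v 1)"
      by (auto simp: k_def simplical_face_simplex2)
  qed
  have "singular_face 2 0 \<kappa> = restrict (\<lambda>u. J (cis (2 * pi * u 1))) (standard_simplex (2 - 1))"
    "singular_face 2 1 \<kappa> = restrict (\<lambda>u. J (of_real (u 1))) (standard_simplex (2 - 1))"
    "singular_face 2 2 \<kappa> = restrict (\<lambda>u. J (of_real (u 1))) (standard_simplex (2 - 1))"
    unfolding \<kappa>_def by (intro singular_face_eqI; simp only: eqs; simp)+
  then have "mod2_boundary 2 (Poly_Mapping.single \<kappa> 1) = Poly_Mapping.single (loop_simplex J) 1"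
    by (simp add: mod2_boundary_single numeral_2_eq_2 loop_simplex_def bit_chain_add_self add.assoc)
  then show ?thesis
    unfolding mod2_boundaries_def using \<kappa>
    by (intro image_eqI[of _ _ "Poly_Mapping.single \<kappa> 1"]) (auto simp: numeral_2_eq_2)
qed

text \<open>The parity of the turns of \<open>f\<close> along a 1-simplex is a cocycle on
  \<open>T\<close>, since a 2-simplex followed by \<open>f\<close> avoids 0 on a whole triangle; on
  the loop its value is 1.\<close>

lemma loop_simplex_not_boundary:
  fixes T :: "'b::topological_space set"
  assumes f: "continuous_on T f" "\<And>x. x \<in> T \<Longrightarrow> f x \<noteq> (0::complex)"
    and J: "continuous_on (sphere 0 1) J" "J ` sphere 0 1 \<subseteq> T"
    and turn: "\<And>z. z \<in> sphere 0 1 \<Longrightarrow> f (J z) / z \<notin> \<real>\<^sub>\<le>\<^sub>0"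
  shows "Poly_Mapping.single (loop_simplex J) 1 \<notin> mod2_boundaries 1 (top_of_set T)"
proof
  assume bd: "Poly_Mapping.single (loop_simplex J) 1 \<in> mod2_boundaries 1 (top_of_set T)"
  define w where "w s = turn_parity (\<lambda>t. f (s (simplex2 (1 - t) t 0)))" for s
  have "mod2_eval w (Poly_Mapping.single (loop_simplex J) 1) = 0"
  proof (rule mod2_eval_boundary[OF bd])
    fix t assume "singular_simplex (Suc 1) (top_of_set T) t"
    then have t: "continuous_on (standard_simplex 2) t" "t ` standard_simplex 2 \<subseteq> T"
      unfolding singular_simplex_top_of_set by (simp_all add: numeral_2_eq_2)
    \<comment> \<open>A copy of the standard 2-simplex in the plane: its vertices 0, 1, 2 correspond
      to the corners 0, 1 and \<open>\<i>\<close>.\<close>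
    define V where "V = {z::complex. 0 \<le> Re z \<and> 0 \<le> Im z \<and> Re z + Im z \<le> 1}"
    define h where "h z = f (t (simplex2 (1 - Re z - Im z) (Re z) (Im z)))" for z
    have V: "simplex2 (1 - Re z - Im z) (Re z) (Im z) \<in> standard_simplex 2" if "z \<in> V" for z
      using that unfolding V_def by (intro simplex2_in) auto
    have V_eq: "V = {z. 0 \<le> 1 \<bullet> z} \<inter> {z. 0 \<le> \<i> \<bullet> z} \<inter> {z. Complex 1 1 \<bullet> z \<le> 1}"
      by (auto simp: V_def inner_complex_def)
    have "convex V"
      unfolding V_eq by (intro convex_Int convex_halfspace_ge convex_halfspace_le)
    moreover have "continuous_on V h"
      unfolding h_def
    proof (rule continuous_on_compose2[OF f(1)])
      show "continuous_on V (\<lambda>z. t (simplex2 (1 - Re z - Im z) (Re z) (Im z)))"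
        by (rule continuous_on_compose2[OF t(1)])
          (intro continuous_on_simplex2 continuous_intros, rule image_subsetI, rule V)
    qed (use V t(2) in blast)
    moreover have "h z \<noteq> 0" if "z \<in> V" for z
      unfolding h_def using V[OF that] t(2) f(2) by blast
    moreover have "0 \<in> V" "1 \<in> V" "\<i> \<in> V" by (auto simp: V_def)
    ultimately have sum0: "turn_parity (h \<circ> linepath 1 \<i>) + turn_parity (h \<circ> linepath 0 \<i>) + turn_parity (h \<circ> linepath 0 1) = 0"
      by (intro turn_parity_triangle)
    have face: "w (singular_face 2 k t) = turn_parity (\<lambda>r. f (t (simplical_face k (simplex2 (1 - r) r 0))))"
      for k
      unfolding w_def singular_face_def
      by (rule turn_parity_cong) (simp add: standard_simplex_1 flip: One_nat_def)
    then have faces: "w (singular_face 2 0 t) = turn_parity (h \<circ> linepath 1 \<i>)"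
      "w (singular_face 2 1 t) = turn_parity (h \<circ> linepath 0 \<i>)"
      "w (singular_face 2 2 t) = turn_parity (h \<circ> linepath 0 1)"
      by (simp_all add: h_def simplical_face_simplex2 linepath_def o_def)
    show "(\<Sum>k\<le>Suc 1. w (singular_face (Suc 1) k t)) = 0"
    proof -
      have "(\<Sum>k\<le>Suc 1. w (singular_face (Suc 1) k t)) =
          w (singular_face 2 0 t) + w (singular_face 2 1 t) + w (singular_face 2 2 t)"
        by (simp only: sum.atMost_Suc One_nat_def atMost_0 sum.insert finite.emptyI empty_iff
            not_False_eq_True sum.empty add_0_right numeral_2_eq_2)
      also have "\<dots> = 0" using sum0 by (simp only: faces)
      finally show ?thesis .
    qed
  qed
  moreover have "w (loop_simplex J) = 1"
  proof -
    have "w (loop_simplex J) = turn_parity (\<lambda>t. f (J (cis (2 * pi * t))))"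
      unfolding w_def loop_simplex_def
      by (rule turn_parity_cong) (simp add: standard_simplex_1 flip: One_nat_def)
    also have "\<dots> = 1"
      using turn continuous_on_compose2[OF f(1) J] by (rule turn_parity_circle[rotated])
    finally show ?thesis .
  qed
  ultimately show False by (simp add: mod2_eval_single)
qed

section \<open>Punctures of a surface with boundary\<close>

definition upper_half :: "complex set" where
  "upper_half = {z. 0 \<le> Im z}"

text \<open>Turning is measured by complex logarithms, so the charts into \<open>real^2\<close> are
  transported to the complex numbers once and for all.\<close>

definition complex_of_vec :: "real^2 \<Rightarrow> complex" where
  "complex_of_vec v = Complex (v $ 1) (v $ 2)"

definition vec_of_complex :: "complex \<Rightarrow> real^2" where
  "vec_of_complex z = (\<chi> i. if i = 1 then Re z else Im z)"

lemma complex_vec_inverse [simp]: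
  "complex_of_vec (vec_of_complex z) = z" "vec_of_complex (complex_of_vec v) = v"
  by (auto simp: complex_of_vec_def vec_of_complex_def vec_eq_iff forall_2)

lemma continuous_on_complex_vec: "continuous_on S complex_of_vec" "continuous_on T vec_of_complex"
proof -
  have eq: "complex_of_vec = (\<lambda>v. of_real (v $ 1) + \<i> * of_real (v $ 2))"
    by (auto simp: complex_of_vec_def complex_eq_iff)
  show "continuous_on S complex_of_vec"
    unfolding eq by (intro continuous_intros)
  have "continuous_on T (\<lambda>z. if i = 1 then Re z else Im z)" for i :: 2
    by (cases "i = 1") (auto intro!: continuous_intros)
  then show "continuous_on T vec_of_complex"
    unfolding vec_of_complex_def by (intro continuous_on_vec_lambda)
qed

lemma homeomorphism_complex_vec:
  "homeomorphism W (complex_of_vec ` W) complex_of_vec vec_of_complex"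
  by (auto simp: homeomorphism_def image_image intro!: continuous_on_complex_vec)

lemma chart_to_complex:
  assumes "subtopology X U homeomorphic_space top_of_set W"
  obtains k k' where "homeomorphic_maps (subtopology X U) (top_of_set (complex_of_vec ` W)) k k'"
proof -
  obtain f g where fg: "homeomorphic_maps (subtopology X U) (top_of_set W) f g"
    using assms unfolding homeomorphic_space_def by blast
  have "homeomorphic_maps (top_of_set W) (top_of_set (complex_of_vec ` W)) complex_of_vec vec_of_complex"
    unfolding homeomorphic_maps_def
    by (auto simp: continuous_map_in_subtopology image_image intro!: continuous_on_complex_vec)
  then show ?thesis
    using homeomorphic_maps_compose fg that by blast
qed

lemma openin_complex_of_vec:
  assumes "openin (top_of_set S) W"
  shows "openin (top_of_set (complex_of_vec ` S)) (complex_of_vec ` W)"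
  using homeomorphism_imp_open_map[OF homeomorphism_complex_vec assms] .

lemma complex_of_vec_half_plane: "complex_of_vec ` half_plane = upper_half"
proof
  show "upper_half \<subseteq> complex_of_vec ` half_plane"
  proof
    fix z assume "z \<in> upper_half"
    then have "vec_of_complex z \<in> half_plane"
      by (auto simp: upper_half_def half_plane_def vec_of_complex_def)
    then show "z \<in> complex_of_vec ` half_plane"
      by (intro image_eqI[of _ _ "vec_of_complex z"]) simp_all
  qed
qed (auto simp: upper_half_def half_plane_def complex_of_vec_def)

lemma complex_of_vec_UNIV: "complex_of_vec ` UNIV = UNIV"
  by (metis complex_vec_inverse(1) surjI)

text \<open>\<open>W\<close> is an arbitrary set here, so that the locale covers both kinds of
  charts: relatively open in the half plane, or open in the plane.\<close>

locale chart =
  fixes X :: "'a topology" and U :: "'a set" and W :: "complex set"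
    and k :: "'a \<Rightarrow> complex" and k' :: "complex \<Rightarrow> 'a"
  assumes Hausdorff: "Hausdorff_space X" and open_U: "openin X U"
    and maps: "homeomorphic_maps (subtopology X U) (top_of_set W) k k'"
begin

lemma U_subset: "U \<subseteq> topspace X"
  using open_U openin_subset by blast

lemma topspace_U [simp]: "topspace X \<inter> U = U"
  using U_subset by auto

lemma cont_k: "continuous_map (subtopology X U) (top_of_set W) k"
  and cont_k': "continuous_map (top_of_set W) (subtopology X U) k'"
  using maps unfolding homeomorphic_maps_def by auto

lemma k_in [simp]: "x \<in> U \<Longrightarrow> k x \<in> W"
  using continuous_map_image_subset_topspace[OF cont_k] by auto

lemma k'_in [simp]: "z \<in> W \<Longrightarrow> k' z \<in> U"
  using continuous_map_image_subset_topspace[OF cont_k'] by auto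

lemma k'_k [simp]: "x \<in> U \<Longrightarrow> k' (k x) = x"
  and k_k' [simp]: "z \<in> W \<Longrightarrow> k (k' z) = z"
  using maps unfolding homeomorphic_maps_def by auto

lemma open_preimage:
  assumes "openin (top_of_set W) Z"
  shows "openin X {x \<in> U. k x \<in> Z}"
proof -
  have "openin X {x \<in> topspace (subtopology X U). k x \<in> Z}"
    by (rule openin_trans_full[OF openin_continuous_map_preimage[OF cont_k assms] open_U])
  then show ?thesis unfolding topspace_subtopology topspace_U .
qed

lemma open_image:
  assumes "openin X T" "T \<subseteq> U"
  shows "openin (top_of_set W) (k ` T)"
proof -
  have "homeomorphic_map (subtopology X U) (top_of_set W) k"
    using maps homeomorphic_map_maps by blast
  moreover have "openin (subtopology X U) T"
    using assms open_U openin_open_subtopology by blast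
  ultimately show ?thesis
    by (meson homeomorphic_map_openness_eq)
qed

lemma closed_preimage:
  assumes "compact K" "K \<subseteq> W"
  shows "closedin X {x \<in> U. k x \<in> K}"
proof -
  have eq: "{x \<in> U. k x \<in> K} = k' ` K"
    using assms(2) by (force intro: image_eqI[of _ k' "k _"])
  have "continuous_map (top_of_set W) X k'"
    using cont_k' continuous_map_into_fulltopology by blast
  moreover have "compactin (top_of_set W) K"
    using assms by (simp add: compactin_subtopology)
  ultimately have "compactin X (k' ` K)" by (meson image_compactin)
  then show ?thesis
    unfolding eq using Hausdorff compactin_imp_closedin by blast
qed

text \<open>A compact set of chart values has a compact, hence closed, preimage in the Hausdorff
  space \<open>X\<close>. Thus \<open>U\<close> and the complement of that preimage form an open
  cover on which the two maps agree. This extends maps modified inside a chart to the whole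
  surface.\<close>

lemma continuous_map_glue:
  assumes K: "compact K" "K \<subseteq> W"
    and f: "continuous_map (subtopology X U) Y f"
    and g: "continuous_map X Y g"
    and eq: "\<And>x. x \<in> U \<Longrightarrow> k x \<notin> K \<Longrightarrow> f x = g x"
  shows "continuous_map X Y (\<lambda>x. if x \<in> U then f x else g x)"
proof -
  define V where "V = topspace X - {x \<in> U. k x \<in> K}"
  have V: "openin X V" unfolding V_def using closed_preimage[OF K] by blast
  show ?thesis
  proof (rule pasting_lemma[where I = UNIV and T = "\<lambda>b::bool. if b then U else V" and f = "\<lambda>b. if b then f else g"])
    show "openin X (if b then U else V)" for b using open_U V by simp
    show "continuous_map (subtopology X (if b then U else V)) Y (if b then f else g)" for b
      using f g continuous_map_from_subtopology by auto
    show "(if i then f else g) x = (if j then f else g) x"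
      if "x \<in> topspace X \<inter> (if i then U else V) \<inter> (if j then U else V)" for i j x
      using that eq unfolding V_def by (cases i; cases j) auto
    show "\<exists>j. j \<in> UNIV \<and> x \<in> (if j then U else V) \<and> (if x \<in> U then f x else g x) = (if j then f else g) x"
      if "x \<in> topspace X" for x
      using that unfolding V_def by (cases "x \<in> U") (auto intro: exI[of _ True] exI[of _ False])
  qed
qed

end

lemma surface_chart:
  assumes "surface X" "x \<in> topspace X"
  obtains U W k k' where "chart X U W k k'" "x \<in> U" "openin (top_of_set upper_half) W"
proof -
  obtain U W where UW: "openin X U" "x \<in> U" "openin (top_of_set half_plane) W"
    "subtopology X U homeomorphic_space top_of_set W"
    using assms unfolding surface_def by blast
  obtain k k' where k: "homeomorphic_maps (subtopology X U) (top_of_set (complex_of_vec ` W)) k k'"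
    using chart_to_complex[OF UW(4)] by metis
  have "openin (top_of_set upper_half) (complex_of_vec ` W)"
    using openin_complex_of_vec[OF UW(3)] by (simp add: complex_of_vec_half_plane)
  moreover have "chart X U (complex_of_vec ` W) k k'"
    using assms UW(1) k by (simp add: chart_def surface_def)
  ultimately show ?thesis using that UW(2) by metis
qed

lemma surface_interior_chart:
  assumes "surface X" "x \<in> surface_interior X"
  obtains U W k k' where "chart X U W k k'" "x \<in> U" "open W"
proof -
  obtain U and W :: "(real^2) set" where UW: "openin X U" "x \<in> U" "open W"
    "subtopology X U homeomorphic_space top_of_set W"
    using assms(2) unfolding surface_interior_def by blast
  obtain k k' where k: "homeomorphic_maps (subtopology X U) (top_of_set (complex_of_vec ` W)) k k'"
    using chart_to_complex[OF UW(4)] by metis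
  have "open (complex_of_vec ` W)"
    using openin_complex_of_vec[of UNIV W] UW(3) by (simp add: complex_of_vec_UNIV)
  moreover have "chart X U (complex_of_vec ` W) k k'"
    using assms UW(1) k by (simp add: chart_def surface_def)
  ultimately show ?thesis using that UW(2) by metis
qed

lemma (in chart) surface_interiorI:
  assumes "open A" "A \<subseteq> W" "x \<in> U" "k x \<in> A"
  shows "x \<in> surface_interior X"
proof -
  define T where "T = {y \<in> U. k y \<in> A}"
  have "openin (top_of_set W) A" using assms open_subset by blast
  then have T: "openin X T" unfolding T_def by (rule open_preimage)
  have "homeomorphic_maps (subtopology X T) (top_of_set A) k k'"
    unfolding homeomorphic_maps_def
  proof (intro conjI ballI)
    have "continuous_map (subtopology (subtopology X U) T) (top_of_set W) k"
      using cont_k continuous_map_from_subtopology by blast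
    moreover have "U \<inter> T = T" unfolding T_def by blast
    ultimately show "continuous_map (subtopology X T) (top_of_set A) k"
      by (auto simp: subtopology_subtopology continuous_map_in_subtopology T_def)
    have "continuous_map (subtopology (top_of_set W) A) (subtopology X U) k'"
      using cont_k' continuous_map_from_subtopology by blast
    moreover have "W \<inter> A = A" using assms by blast
    ultimately have "continuous_map (top_of_set A) X k'"
      by (simp add: subtopology_subtopology continuous_map_in_subtopology)
    then show "continuous_map (top_of_set A) (subtopology X T) k'"
      using assms(2) by (auto simp: continuous_map_in_subtopology T_def subset_iff)
  qed (use assms(2) in \<open>auto simp: T_def subset_iff\<close>)
  moreover have "homeomorphic_maps (top_of_set A) (top_of_set (vec_of_complex ` A)) vec_of_complex complex_of_vec"
    unfolding homeomorphic_maps_def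
    by (auto simp: continuous_map_in_subtopology image_image intro!: continuous_on_complex_vec)
  ultimately have "subtopology X T homeomorphic_space top_of_set (vec_of_complex ` A)"
    using homeomorphic_maps_compose homeomorphic_space_def by blast
  moreover have "open (vec_of_complex ` A)"
  proof -
    have "homeomorphism UNIV (vec_of_complex ` UNIV) vec_of_complex complex_of_vec"
      by (auto simp: homeomorphism_def image_image intro!: continuous_on_complex_vec)
    moreover have "vec_of_complex ` UNIV = UNIV" by (metis complex_vec_inverse(2) surjI)
    ultimately show ?thesis using homeomorphism_imp_open_map[of UNIV UNIV] assms(1) by auto
  qed
  ultimately show ?thesis
    unfolding surface_interior_def using T assms U_subset by (auto simp: T_def)
qed

text \<open>Half discs are convex, so surfaces are locally path connected. The path is what makes
  the difference of two points a boundary in the 0-tightness argument.\<close>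

lemma surface_path_connected:
  assumes X: "surface X" "connected_space X"
  shows "path_connected_space X"
proof -
  have "locally_path_connected_space X"
    unfolding locally_path_connected_space
  proof (intro allI impI, elim conjE)
    fix V x assume V: "openin X V" "x \<in> V"
    then have "x \<in> topspace X" using openin_subset by blast
    then obtain U W k k' where ch: "chart X U W k k'" and x: "x \<in> U" and W: "openin (top_of_set upper_half) W"
      using surface_chart[OF X(1)] by metis
    interpret chart X U W k k' by (rule ch)
    have "openin (top_of_set W) (k ` (V \<inter> U))"
      using open_image V open_U by blast
    then have "openin (top_of_set upper_half) (k ` (V \<inter> U))"
      using W openin_trans by blast
    moreover have "k x \<in> k ` (V \<inter> U)" using V x by blast
    ultimately obtain e where e: "0 < e" "ball (k x) e \<inter> upper_half \<subseteq> k ` (V \<inter> U)"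
      unfolding openin_contains_ball by metis
    define B where "B = ball (k x) e \<inter> upper_half"
    have BW: "B \<subseteq> W" using e k_in unfolding B_def by blast
    have "openin (top_of_set upper_half) B"
      unfolding B_def by (metis inf_commute open_ball openin_open_Int)
    then have "openin (top_of_set W) B"
      using BW openin_imp_subset[OF W] by (rule openin_subset_trans)
    then have "openin X {y \<in> U. k y \<in> B}" by (rule open_preimage)
    moreover have "path_connectedin X {y \<in> U. k y \<in> B}"
    proof -
      have "convex upper_half" unfolding upper_half_def by (rule convex_halfspace_Im_ge)
      then have "path_connectedin (top_of_set W) B"
        using BW by (simp add: path_connectedin_subtopology B_def convex_imp_path_connected convex_Int)
      moreover have "continuous_map (top_of_set W) X k'"
        using cont_k' continuous_map_into_fulltopology by blast
      ultimately have "path_connectedin X (k' ` B)"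
        by (meson path_connectedin_continuous_map_image)
      moreover have "k' ` B = {y \<in> U. k y \<in> B}"
        using BW by (force intro: image_eqI[of _ k' "k _"])
      ultimately show ?thesis by simp
    qed
    moreover have "k x \<in> B"
      using e x W k_in openin_imp_subset unfolding B_def by fastforce
    moreover have "{y \<in> U. k y \<in> B} \<subseteq> V"
    proof
      fix y assume y: "y \<in> {y \<in> U. k y \<in> B}"
      then obtain v where "v \<in> V" "v \<in> U" "k y = k v" using e(2) unfolding B_def by blast
      then show "y \<in> V" using y k'_k by (metis (no_types, lifting) mem_Collect_eq)
    qed
    ultimately show "\<exists>T. openin X T \<and> path_connectedin X T \<and> x \<in> T \<and> T \<subseteq> V"
      using x by blast
  qed
  then show ?thesis
    using X(2) path_connected_eq_connected_space by blast
qed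

text \<open>A puncture is detectable if some map to the punctured plane sees a loop that bounds a disc
  in \<open>X\<close> but surrounds the puncture. Never being antipodal to the identity of the circle forces the
  loop to wind once.\<close>

definition detectable_puncture :: "'a topology \<Rightarrow> 'a \<Rightarrow> bool" where
  "detectable_puncture X p \<longleftrightarrow> (\<exists>(f :: 'a \<Rightarrow> complex) j.
     continuous_map (subtopology X (topspace X - {p})) euclidean f \<and>
     (\<forall>x \<in> topspace X - {p}. f x \<noteq> 0) \<and>
     continuous_map (top_of_set (cball 0 1)) X j \<and> p \<notin> j ` sphere 0 1 \<and>
     (\<forall>z \<in> sphere 0 1. f (j z) / z \<notin> \<real>\<^sub>\<le>\<^sub>0))"

lemma detectable_puncture_homeomorphic:
  assumes "detectable_puncture X p" and hom: "homeomorphic_maps X X H G" and "H p = q" "p \<in> topspace X"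
  shows "detectable_puncture X q"
proof -
  obtain f :: "'a \<Rightarrow> complex" and j where f: "continuous_map (subtopology X (topspace X - {p})) euclidean f"
    "\<And>x. x \<in> topspace X - {p} \<Longrightarrow> f x \<noteq> 0"
    and j: "continuous_map (top_of_set (cball 0 1)) X j" "p \<notin> j ` sphere 0 1"
    and turn: "\<And>z. z \<in> sphere 0 1 \<Longrightarrow> f (j z) / z \<notin> \<real>\<^sub>\<le>\<^sub>0"
    using assms(1) unfolding detectable_puncture_def by blast
  have H: "continuous_map X X H" and G: "continuous_map X X G"
    and GH: "\<And>x. x \<in> topspace X \<Longrightarrow> G (H x) = x" and HG: "\<And>x. x \<in> topspace X \<Longrightarrow> H (G x) = x"
    using hom unfolding homeomorphic_maps_def by auto
  have Gin: "G x \<in> topspace X" if "x \<in> topspace X" for x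
    using continuous_map_image_subset_topspace[OF G] that by blast
  have Gp: "G x \<in> topspace X - {p}" if "x \<in> topspace X - {q}" for x
    using that Gin HG assms(3) by fastforce
  have jin: "j z \<in> topspace X" if "z \<in> cball 0 1" for z
    using continuous_map_image_subset_topspace[OF j(1)] that by auto
  have "continuous_map (subtopology X (topspace X - {q})) (subtopology X (topspace X - {p})) G"
    using G Gp by (auto simp: continuous_map_in_subtopology continuous_map_from_subtopology)
  then have "continuous_map (subtopology X (topspace X - {q})) euclidean (f \<circ> G)"
    using f(1) continuous_map_compose by blast
  moreover have "(f \<circ> G) x \<noteq> 0" if "x \<in> topspace X - {q}" for x
    using f(2)[OF Gp[OF that]] by simp
  moreover have "continuous_map (top_of_set (cball 0 1)) X (H \<circ> j)"
    using H j(1) continuous_map_compose by blast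
  moreover have "q \<notin> (H \<circ> j) ` sphere 0 1"
  proof
    assume "q \<in> (H \<circ> j) ` sphere 0 1"
    then obtain z where z: "z \<in> sphere 0 1" "q = H (j z)" by auto
    then have "j z = G q" using GH[OF jin[of z]] by simp
    also have "\<dots> = p" using GH assms(3,4) by blast
    finally show False using j(2) z(1) by blast
  qed
  moreover have "(f \<circ> G) ((H \<circ> j) z) / z \<notin> \<real>\<^sub>\<le>\<^sub>0" if "z \<in> sphere 0 1" for z
    using turn[OF that] GH[OF jin[of z]] that by simp
  ultimately show ?thesis
    unfolding detectable_puncture_def by blast
qed

text \<open>A homeomorphism of the plane that is the identity outside \<open>A\<close> can take
  \<open>k p\<close> to \<open>k q\<close>; conjugated by the chart and extended by the identity it
  becomes a homeomorphism of \<open>X\<close>. The compact set \<open>K\<close> is separate from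
  \<open>A\<close> because \<open>A\<close> may be an open half disc whose closure touches the
  boundary line: what has to be compact in \<open>W\<close> is a set around the support.\<close>

lemma (in chart) detectable_puncture_move:
  assumes K: "compact K" "K \<subseteq> W" and A: "open A" "convex A" "A \<subseteq> K"
    and p: "p \<in> U" "k p \<in> A" "detectable_puncture X p" and q: "q \<in> U" "k q \<in> A"
  shows "detectable_puncture X q"
proof -
  have affA: "affine hull A = UNIV" using affine_hull_open A p by blast
  obtain h g where hg: "homeomorphism UNIV UNIV h g" "h (k p) = k q"
    "{x. \<not> (h x = x \<and> g x = x)} \<subseteq> A"
  proof (rule homeomorphism_moving_point[of A UNIV "k p" "k q"])
    show "openin (top_of_set (affine hull A)) A" using affA A(1) by simp
    show "connected A" using A(2) by (rule convex_connected)
  qed (use affA p q that in auto)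
  have fixh: "h z = z" "g z = z" if "z \<notin> A" for z using hg(3) that by auto
  have inv: "g (h z) = z" "h (g z) = z" for z using hg(1) by (auto simp: homeomorphism_def)
  have AW: "A \<subseteq> W" using A K by blast
  have hA: "h z \<in> A \<longleftrightarrow> z \<in> A" "g z \<in> A \<longleftrightarrow> z \<in> A" for z
    using fixh inv by metis+
  have hW: "h z \<in> W" "g z \<in> W" if "z \<in> W" for z
    using that hA fixh AW by (metis subsetD)+
  have cont: "continuous_map X X (\<lambda>x. if x \<in> U then k' (h' (k x)) else x)"
    if h': "continuous_on UNIV h'" "\<And>z. z \<in> W \<Longrightarrow> h' z \<in> W" "\<And>z. z \<notin> A \<Longrightarrow> h' z = z" for h'
  proof (rule continuous_map_glue[OF K])
    have "continuous_map (top_of_set W) (top_of_set W) h'"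
      using h'(2) continuous_on_subset[OF h'(1)] by auto
    then have "continuous_map (subtopology X U) (subtopology X U) (k' \<circ> (h' \<circ> k))"
      by (intro continuous_map_compose[OF continuous_map_compose[OF cont_k] cont_k'])
    then show "continuous_map (subtopology X U) X (\<lambda>x. k' (h' (k x)))"
      by (simp add: continuous_map_in_subtopology o_def)
    show "k' (h' (k x)) = x" if "x \<in> U" "k x \<notin> K" for x
      using that h'(3) A by (metis k'_k subsetD)
  qed auto
  define H where "H x = (if x \<in> U then k' (h (k x)) else x)" for x
  define G where "G x = (if x \<in> U then k' (g (k x)) else x)" for x
  have "homeomorphic_maps X X H G"
    unfolding homeomorphic_maps_def
  proof (intro conjI ballI)
    show "continuous_map X X H" unfolding H_def
      using hg(1) hW fixh by (intro cont) (auto simp: homeomorphism_def)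
    show "continuous_map X X G" unfolding G_def
      using hg(1) hW fixh by (intro cont) (auto simp: homeomorphism_def)
    show "G (H x) = x" "H (G x) = x" for x
      unfolding H_def G_def by (auto simp: hW inv)
  qed
  moreover have "H p = q" unfolding H_def using p q hg(2) by simp
  moreover have "p \<in> topspace X" using p U_subset by blast
  ultimately show ?thesis
    by (rule detectable_puncture_homeomorphic[OF p(3)])
qed

text \<open>Near a boundary point, the angle around the puncture can be flattened to a constant along the
  arc that cuts off a half disc, so it extends to the rest of the surface.\<close>

definition half_disc_map :: "complex \<Rightarrow> complex" where
  "half_disc_map z = (let s = min 1 (max 0 (2 * norm z - 1)) in of_real (1 - s) * (z - \<i> / 2) + of_real s * \<i>)"

lemma continuous_on_half_disc_map: "continuous_on S half_disc_map"
  unfolding half_disc_map_def Let_def by (intro continuous_intros)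

lemma half_disc_map_outside: "1 \<le> norm z \<Longrightarrow> half_disc_map z = \<i>"
  by (simp add: half_disc_map_def)

text \<open>An interpolation between \<open>z - \<i> / 2\<close> and \<open>\<i>\<close> can vanish
  only if \<open>z - \<i> / 2\<close> is 0 or points straight down. In the upper half plane such
  \<open>z\<close> have norm at most \<open>1 / 2\<close>, where the interpolation has not
  started.\<close>

lemma half_disc_map_nonzero:
  assumes "0 \<le> Im z" "z \<noteq> \<i> / 2"
  shows "half_disc_map z \<noteq> 0"
proof
  assume eq: "half_disc_map z = 0"
  define s where "s = min 1 (max 0 (2 * norm z - 1))"
  have s: "0 \<le> s" "s \<le> 1" unfolding s_def by auto
  have "of_real (1 - s) * (z - \<i> / 2) + of_real s * \<i> = 0"
    using eq by (simp add: half_disc_map_def Let_def s_def)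
  then have re: "(1 - s) * Re z = 0" and im: "(1 - s) * (Im z - 1 / 2) + s = 0"
    by (auto simp: complex_eq_iff)
  show False
  proof (cases "s = 1")
    case False
    then have z: "Re z = 0" "0 < 1 - s" using re s by auto
    have "(1 - s) * (Im z - 1 / 2) \<le> 0" using im s by linarith
    then have le: "Im z \<le> 1 / 2" using z(2) by (simp add: mult_le_0_iff)
    have "norm z = Im z" using z(1) assms(1) by (simp add: cmod_def)
    then have "s = 0" using le unfolding s_def by simp
    then have "Im z = 1 / 2" using im by simp
    then show False using assms(2) z(1) by (simp add: complex_eq_iff)
  qed (use im in simp)
qed

text \<open>On the circle of radius \<open>1 / 4\<close> around the puncture
  \<open>\<i> / 2\<close>, the value could be a nonpositive multiple of \<open>\<zeta>\<close> only
  for \<open>\<zeta> = - \<i>\<close>, because the interpolation pushes upwards. But there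
  \<open>z = \<i> / 4\<close> and nothing has been pushed yet.\<close>

lemma half_disc_map_circle:
  assumes "norm \<zeta> = 1"
  shows "half_disc_map (\<i> / 2 + \<zeta> / 4) / \<zeta> \<notin> \<real>\<^sub>\<le>\<^sub>0"
proof
  assume neg: "half_disc_map (\<i> / 2 + \<zeta> / 4) / \<zeta> \<in> \<real>\<^sub>\<le>\<^sub>0"
  have "\<zeta> \<noteq> 0" using assms by auto
  obtain t where t: "0 \<le> t" "half_disc_map (\<i> / 2 + \<zeta> / 4) = - of_real t * \<zeta>"
  proof -
    obtain r where r: "half_disc_map (\<i> / 2 + \<zeta> / 4) / \<zeta> = of_real r" "r \<le> 0"
      using neg by (auto elim: nonpos_Reals_cases)
    then have "half_disc_map (\<i> / 2 + \<zeta> / 4) = of_real r * \<zeta>"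
      using \<open>\<zeta> \<noteq> 0\<close> by (simp add: divide_eq_eq)
    then show ?thesis using that[of "- r"] r(2) by simp
  qed
  define s where "s = min 1 (max 0 (2 * norm (\<i> / 2 + \<zeta> / 4) - 1))"
  \<comment> \<open>Norm at most \<open>3 / 4\<close> keeps \<open>s\<close> at most
    \<open>1 / 2\<close>, so the coefficient of \<open>z - \<i> / 2\<close> stays positive.\<close>
  have "norm (\<i> / 2 + \<zeta> / 4) \<le> 3 / 4"
    using norm_triangle_ineq[of "\<i> / 2" "\<zeta> / 4"] assms by (simp add: norm_divide)
  then have s: "0 \<le> s" "s \<le> 1 / 2" unfolding s_def by linarith+
  have "of_real (1 - s) * (\<zeta> / 4) + of_real s * \<i> = - of_real t * \<zeta>"
    using t(2) by (simp add: half_disc_map_def Let_def s_def)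
  then have "(1 - s) * (Re \<zeta> / 4) = - t * Re \<zeta>" "(1 - s) * (Im \<zeta> / 4) + s = - t * Im \<zeta>"
    by (auto simp: complex_eq_iff)
  then have re: "((1 - s) / 4 + t) * Re \<zeta> = 0" and im: "((1 - s) / 4 + t) * Im \<zeta> = - s"
    by (simp_all add: field_simps)
  have pos: "0 < (1 - s) / 4 + t" using s t(1) by (intro add_pos_nonneg) auto
  then have "Re \<zeta> = 0" using re by auto
  moreover have "Im \<zeta> \<le> 0"
    using im s(1) pos by (metis mult_pos_pos neg_le_0_iff_le not_le)
  ultimately have "Im \<zeta> = - 1" using assms by (simp add: cmod_def)
  then have "\<zeta> = - \<i>" using \<open>Re \<zeta> = 0\<close> by (simp add: complex_eq_iff)
  then have "s = 0" unfolding s_def by (simp add: norm_divide)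
  then show False using im pos \<open>Im \<zeta> = - 1\<close> by simp
qed

text \<open>The chart is rescaled so that \<open>k x\<close> becomes 0 and a half disc of radius
  \<open>r\<close> in \<open>W\<close> becomes the unit half disc. The puncture is then
  \<open>\<i> / 2\<close>, the disc \<open>J\<close> is the one of radius \<open>1 / 4\<close>
  around it, and the map is \<open>half_disc_map\<close>.\<close>

lemma (in chart) detectable_puncture_near_boundary:
  assumes W: "openin (top_of_set upper_half) W" and x: "x \<in> U" "Im (k x) = 0"
  obtains p where "p \<in> U" "0 < Im (k p)" "detectable_puncture X p"
proof -
  define w where "w = k x"
  have "w \<in> W" unfolding w_def using x by simp
  then obtain e where e: "0 < e" "ball w e \<inter> upper_half \<subseteq> W"
    using W unfolding openin_contains_ball by metis
  define r where "r = e / 2"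
  have r: "0 < r" "cball w r \<inter> upper_half \<subseteq> W"
    using e unfolding r_def by auto
  have w0: "Im w = 0" using x w_def by simp
  define N where "N = cball w r \<inter> upper_half"
  have "closed upper_half" unfolding upper_half_def by (rule closed_halfspace_Im_ge)
  then have N: "compact N" "N \<subseteq> W" unfolding N_def using r by (auto intro: compact_Int_closed)
  define n where "n z = (z - w) / of_real r" for z
  \<comment> \<open>Outside the half disc \<open>half_disc_map\<close> is already
    \<open>\<i>\<close>, so this constant continues it over the rest of the surface without a jump
    and without a zero.\<close>
  define f where "f y = (if y \<in> U then half_disc_map (n (k y)) else \<i>)" for y
  define J where "J \<zeta> = w + of_real r * (\<i> / 2 + \<zeta> / 4)" for \<zeta>
  define p where "p = k' (w + of_real r * (\<i> / 2))"
  have WU: "W \<subseteq> upper_half" using W openin_imp_subset by blast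
  have JN: "J \<zeta> \<in> N" if "norm \<zeta> \<le> 1" for \<zeta>
  proof -
    have "norm (\<i> / 2 + \<zeta> / 4) \<le> 1"
      using norm_triangle_ineq[of "\<i> / 2" "\<zeta> / 4"] that by (simp add: norm_divide)
    then have "norm (of_real r * (\<i> / 2 + \<zeta> / 4)) \<le> r"
      using r(1) by (simp add: norm_mult)
    moreover have "\<bar>Im \<zeta>\<bar> \<le> 1" using that abs_Im_le_cmod order_trans by blast
    then have "0 \<le> r * (1 / 2 + Im \<zeta> / 4)" using r(1) by (intro mult_nonneg_nonneg) auto
    ultimately show ?thesis
      using w0 unfolding N_def J_def upper_half_def by (simp add: dist_norm norm_minus_commute)
  qed
  have p0: "J 0 = w + of_real r * (\<i> / 2)" unfolding J_def by simp
  have pW: "w + of_real r * (\<i> / 2) \<in> W" using JN[of 0] N(2) p0 by auto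
  have nJ: "n (J \<zeta>) = \<i> / 2 + \<zeta> / 4" for \<zeta> unfolding n_def J_def using r by simp
  have pU: "p \<in> U" and kp: "k p = w + of_real r * (\<i> / 2)" unfolding p_def using pW by auto
  have "continuous_map X euclidean f"
    unfolding f_def
  proof (rule continuous_map_glue[OF N])
    have "continuous_map (top_of_set W) euclidean (\<lambda>z. half_disc_map (n z))"
      unfolding n_def using r
      by (auto intro!: continuous_intros continuous_on_compose2[OF continuous_on_half_disc_map[of UNIV]])
    then have "continuous_map (subtopology X U) euclidean ((\<lambda>z. half_disc_map (n z)) \<circ> k)"
      using cont_k continuous_map_compose by blast
    then show "continuous_map (subtopology X U) euclidean (\<lambda>y. half_disc_map (n (k y)))"
      by (simp add: o_def)
    show "half_disc_map (n (k y)) = \<i>" if "y \<in> U" "k y \<notin> N" for y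
    proof (rule half_disc_map_outside)
      have "k y \<in> upper_half" using that WU by (simp add: subset_iff)
      then have "r < dist w (k y)" using that unfolding N_def by auto
      then show "1 \<le> norm (n (k y))"
        using r unfolding n_def by (simp add: norm_divide dist_norm norm_minus_commute)
    qed
  qed auto
  then have "continuous_map (subtopology X (topspace X - {p})) euclidean f"
    by (rule continuous_map_from_subtopology)
  moreover have "f y \<noteq> 0" if y: "y \<in> topspace X - {p}" for y
  proof (cases "y \<in> U")
    case True
    have "k y \<noteq> k p" using y True pU k'_k by (metis DiffE singletonI)
    then have "n (k y) \<noteq> \<i> / 2" using kp r unfolding n_def by (auto simp: field_simps)
    moreover have "0 \<le> Im (n (k y))"
    proof -
      have "0 \<le> Im (k y)" using True WU k_in upper_half_def by blast
      then show ?thesis using r w0 unfolding n_def by simp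
    qed
    ultimately show ?thesis unfolding f_def using True half_disc_map_nonzero by simp
  qed (simp add: f_def)
  moreover have "continuous_map (top_of_set (cball 0 1)) X (k' \<circ> J)"
  proof (rule continuous_map_compose)
    show "continuous_map (top_of_set (cball 0 1)) (top_of_set W) J"
      using JN N(2) unfolding J_def by (auto intro!: continuous_intros)
    show "continuous_map (top_of_set W) X k'" using cont_k' continuous_map_into_fulltopology by blast
  qed
  moreover have "p \<notin> (k' \<circ> J) ` sphere 0 1"
  proof
    assume "p \<in> (k' \<circ> J) ` sphere 0 1"
    then obtain \<zeta> where \<zeta>: "norm \<zeta> = 1" "p = k' (J \<zeta>)" by auto
    then have "J \<zeta> = J 0" using kp p0 JN[of \<zeta>] N(2) k_k' by (metis order_refl subsetD)
    then show False using r \<zeta>(1) unfolding J_def by auto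
  qed
  moreover have "f ((k' \<circ> J) \<zeta>) / \<zeta> \<notin> \<real>\<^sub>\<le>\<^sub>0" if "\<zeta> \<in> sphere 0 1" for \<zeta>
  proof -
    have "norm \<zeta> = 1" using that by simp
    moreover have "J \<zeta> \<in> W" using JN[of \<zeta>] N(2) that by auto
    ultimately show ?thesis using half_disc_map_circle unfolding f_def by (simp add: nJ)
  qed
  ultimately have "detectable_puncture X p"
    unfolding detectable_puncture_def by blast
  moreover have "0 < Im (k p)" using kp w0 r by simp
  ultimately show ?thesis using that pU by blast
qed

text \<open>The closure of the set \<open>G\<close> of detectable interior points is open, closed
  and nonempty, hence everything. An interior point therefore has detectable points arbitrarily
  close to it, and detectability is locally constant on the interior.\<close>

lemma surface_interior_detectable:
  assumes X: "surface X" "connected_space X" "surface_boundary X \<noteq> {}" and p: "p \<in> surface_interior X"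
  shows "detectable_puncture X p"
proof -
  define G where "G = {q \<in> surface_interior X. detectable_puncture X q}"
  have intX: "surface_interior X \<subseteq> topspace X" unfolding surface_interior_def by blast
  have near: "\<exists>T. openin X T \<and> q \<in> T \<and> T \<subseteq> surface_interior X \<and>
      (\<forall>u\<in>T. \<forall>v\<in>T. detectable_puncture X u \<longrightarrow> detectable_puncture X v)"
    if q: "q \<in> surface_interior X" for q
  proof -
    obtain U W k k' where ch: "chart X U W k k'" and qU: "q \<in> U" and W: "open W"
      using surface_interior_chart[OF X(1) q] by metis
    interpret chart X U W k k' by (rule ch)
    obtain e where e: "0 < e" "cball (k q) e \<subseteq> W" using W qU k_in open_contains_cball by blast
    define T where "T = {y \<in> U. k y \<in> ball (k q) e}"
    have bW: "ball (k q) e \<subseteq> W" using e ball_subset_cball by blast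
    then have "openin X T" unfolding T_def by (intro open_preimage open_subset) auto
    moreover have "q \<in> T" unfolding T_def using qU e by simp
    moreover have "T \<subseteq> surface_interior X"
      unfolding T_def using surface_interiorI[OF open_ball bW] by blast
    moreover have "detectable_puncture X v" if "u \<in> T" "v \<in> T" "detectable_puncture X u" for u v
      using detectable_puncture_move[of "cball (k q) e" "ball (k q) e" u v] e that unfolding T_def by auto
    ultimately show ?thesis by blast
  qed
  \<comment> \<open>The point \<open>x\<close> may be a boundary point, so a half-plane chart is
    used. Over the open half disc \<open>A\<close> detectability holds everywhere once it holds
    somewhere, and every point of the neighbourhood \<open>Q\<close> is a limit of points over
    \<open>A\<close>.\<close>
  have "openin X (X closure_of G)"
    unfolding openin_subopen[of X "X closure_of G"]
  proof
    fix x assume x: "x \<in> X closure_of G"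
    then have "x \<in> topspace X" unfolding in_closure_of by blast
    then obtain U W k k' where ch: "chart X U W k k'" and xU: "x \<in> U" and W: "openin (top_of_set upper_half) W"
      using surface_chart[OF X(1)] by metis
    interpret chart X U W k k' by (rule ch)
    have WU: "W \<subseteq> upper_half" using W openin_imp_subset by blast
    have "k x \<in> W" using xU by simp
    then obtain e where e: "0 < e" "ball (k x) e \<inter> upper_half \<subseteq> W"
      using W unfolding openin_contains_ball by metis
    define r where "r = e / 2"
    have r: "0 < r" "cball (k x) r \<inter> upper_half \<subseteq> W"
      using e unfolding r_def by auto
    define K where "K = cball (k x) r \<inter> upper_half"
    have "closed upper_half" unfolding upper_half_def by (rule closed_halfspace_Im_ge)
    then have K: "compact K" "K \<subseteq> W" unfolding K_def using r by (auto intro: compact_Int_closed)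
    define A where "A = ball (k x) r \<inter> {z. 0 < Im z}"
    have A: "open A" "convex A" "A \<subseteq> K"
      unfolding A_def K_def upper_half_def
      by (auto intro!: open_Int convex_Int open_halfspace_Im_gt convex_halfspace_Im_gt)
    have AW: "A \<subseteq> W" using A K by blast
    define Q where "Q = {y \<in> U. k y \<in> ball (k x) r}"
    have "openin (top_of_set W) (W \<inter> ball (k x) r)" by (simp add: openin_open_Int)
    then have "openin X {y \<in> U. k y \<in> W \<inter> ball (k x) r}" by (rule open_preimage)
    moreover have "{y \<in> U. k y \<in> W \<inter> ball (k x) r} = Q" unfolding Q_def by auto
    ultimately have Q: "openin X Q" by simp
    have xQ: "x \<in> Q" unfolding Q_def using xU r by simp
    \<comment> \<open>Points over the boundary line of the half plane are limits of points above it.\<close>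
    have above: "\<exists>y \<in> T. y \<in> U \<and> k y \<in> A" if T: "openin X T" "T \<inter> Q \<noteq> {}" for T
    proof -
      have "openin (top_of_set W) (k ` (T \<inter> Q))"
        using T Q by (intro open_image openin_Int) (auto simp: Q_def)
      then have "openin (top_of_set upper_half) (k ` (T \<inter> Q))" using W openin_trans by blast
      moreover obtain y where y: "y \<in> T \<inter> Q" using T by blast
      ultimately obtain d where d: "0 < d" "ball (k y) d \<inter> upper_half \<subseteq> k ` (T \<inter> Q)"
        unfolding openin_contains_ball by (metis imageI)
      define z where "z = k y + of_real (d / 2) * \<i>"
      have "k y \<in> upper_half" using y WU unfolding Q_def by (auto simp: subset_iff)
      then have z: "z \<in> ball (k y) d \<inter> upper_half" "0 < Im z"
        using d unfolding z_def upper_half_def by (auto simp: dist_norm norm_mult)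
      then obtain v where v: "v \<in> T" "v \<in> Q" "k v = z" using d by blast
      then show ?thesis using z(2) unfolding Q_def A_def by blast
    qed
    have "Q \<inter> G \<noteq> {}" using x Q xQ unfolding in_closure_of by blast
    then obtain g where g: "g \<in> Q" "g \<in> surface_interior X" "detectable_puncture X g"
      unfolding G_def by blast
    \<comment> \<open>The chart value of \<open>g\<close> might lie on the boundary line, hence
      outside \<open>A\<close>. Local constancy around \<open>g\<close> passes detectability to a
      nearby point \<open>y\<close> over \<open>A\<close>.\<close>
    obtain T where T: "openin X T" "g \<in> T" "\<And>u v. u \<in> T \<Longrightarrow> v \<in> T \<Longrightarrow> detectable_puncture X u \<Longrightarrow> detectable_puncture X v"
      using near[OF g(2)] by blast
    have "T \<inter> Q \<noteq> {}" using T(2) g(1) by blast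
    then obtain y where y: "y \<in> T" "y \<in> U" "k y \<in> A" using above[OF T(1)] by blast
    have "detectable_puncture X y" using T(3)[OF T(2) y(1) g(3)] .
    then have all: "v \<in> G" if "v \<in> U" "k v \<in> A" for v
      unfolding G_def using detectable_puncture_move[OF K A y(2,3) _ that] surface_interiorI[OF A(1) AW that] by blast
    have "Q \<subseteq> X closure_of G"
    proof
      fix v assume v: "v \<in> Q"
      then have "v \<in> topspace X" using Q openin_subset by blast
      moreover have "\<exists>y. y \<in> G \<and> y \<in> T" if "v \<in> T" "openin X T" for T
        using above[of T] all that v by blast
      ultimately show "v \<in> X closure_of G" unfolding in_closure_of by blast
    qed
    then show "\<exists>T. openin X T \<and> x \<in> T \<and> T \<subseteq> X closure_of G" using Q xQ by blast
  qed
  moreover have "closedin X (X closure_of G)" by simp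
  moreover have "X closure_of G \<noteq> {}"
  proof -
    obtain b where b: "b \<in> topspace X" "b \<notin> surface_interior X"
      using X(3) unfolding surface_boundary_def by blast
    obtain U W k k' where ch: "chart X U W k k'" and bU: "b \<in> U" and W: "openin (top_of_set upper_half) W"
      using surface_chart[OF X(1) b(1)] by metis
    interpret chart X U W k k' by (rule ch)
    obtain O' where O': "open O'" "W = O' \<inter> upper_half" using W unfolding openin_open by blast
    \<comment> \<open>Points over the open upper half plane are interior, so the chart must send the
      boundary point \<open>b\<close> to the line, where the explicit construction starts.\<close>
    have pos: "y \<in> surface_interior X" if "y \<in> U" "0 < Im (k y)" for y
    proof (rule surface_interiorI[of "O' \<inter> {z. 0 < Im z}"])
      show "open (O' \<inter> {z. 0 < Im z})" using O' by (simp add: open_Int open_halfspace_Im_gt)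
      show "O' \<inter> {z. 0 < Im z} \<subseteq> W" using O' unfolding upper_half_def by auto
      show "k y \<in> O' \<inter> {z. 0 < Im z}" using that k_in O' by blast
    qed (rule that)
    have "0 \<le> Im (k b)" using k_in[OF bU] O' unfolding upper_half_def by blast
    then have "Im (k b) = 0" using pos[OF bU] b(2) by fastforce
    then obtain g where "g \<in> U" "0 < Im (k g)" "detectable_puncture X g"
      using detectable_puncture_near_boundary[OF W bU] by metis
    then have "g \<in> G" unfolding G_def using pos by blast
    then show ?thesis using closure_of_subset[of G X] intX unfolding G_def by blast
  qed
  ultimately have "X closure_of G = topspace X"
    using X(2) unfolding connected_space_clopen_in by blast
  moreover obtain T where T: "openin X T" "p \<in> T"
    "\<And>u v. u \<in> T \<Longrightarrow> v \<in> T \<Longrightarrow> detectable_puncture X u \<Longrightarrow> detectable_puncture X v"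
    using near[OF p] by blast
  moreover have "p \<in> topspace X" using p intX by blast
  ultimately have "p \<in> X closure_of G" by simp
  then obtain g where "g \<in> G" "g \<in> T"
    using \<open>openin X T\<close> \<open>p \<in> T\<close> unfolding in_closure_of by blast
  then show ?thesis using T unfolding G_def by blast
qed

section \<open>The convex hull of a tight polyhedral surface\<close>

lemma extreme_point_of_mono: "v extreme_point_of P \<Longrightarrow> Q \<subseteq> P \<Longrightarrow> v \<in> Q \<Longrightarrow> v extreme_point_of Q"
  unfolding extreme_point_of_def by blast

lemma extreme_point_in_segment:
  fixes v :: "'b::euclidean_space"
  assumes "v extreme_point_of P" "closed_segment a b \<subseteq> P" "v \<in> closed_segment a b"
  shows "v = a \<or> v = b"
proof -
  have "v extreme_point_of closed_segment a b" using assms by (blast intro: extreme_point_of_mono)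
  then show ?thesis by (simp add: extreme_point_of_segment)
qed

text \<open>Extreme points of the hull lie in the image and remain extreme in every part of it that
  contains them. In a segment this leaves the two ends. In a polygon it excludes the relative
  interior and so leads to a segment of its frontier. All these ends form the finite set
  \<open>Z\<close>.\<close>

lemma polyhedral_embedding_finite_extreme_points:
  fixes \<phi> :: "'a \<Rightarrow> 'b::euclidean_space"
  assumes "polyhedral_embedding X \<phi>"
  shows "finite {v. v extreme_point_of (convex hull (\<phi> ` topspace X))}"
proof -
  define P where "P = convex hull (\<phi> ` topspace X)"
  have KP: "\<phi> ` topspace X \<subseteq> P" unfolding P_def by (rule hull_subset)
  obtain V E F where dec: "cell_decomposition X V E F"
    and e: "\<And>e. e \<in> E \<Longrightarrow> \<exists>a b. \<phi> ` (X closure_of e) = closed_segment a b"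
    and f: "\<And>f. f \<in> F \<Longrightarrow> planar_polygon (\<phi> ` (X closure_of f))"
    using assms unfolding polyhedral_embedding_def by blast
  have fin: "finite V" "finite E" "finite F" and un: "\<Union>((\<lambda>v. {v}) ` V \<union> E \<union> F) = topspace X"
    using dec unfolding cell_decomposition_def partition_on_def by auto
  have cl: "c \<subseteq> X closure_of c" "\<phi> ` (X closure_of c) \<subseteq> P" if "c \<in> E \<union> F" for c
  proof -
    have "c \<subseteq> topspace X" using that un by blast
    then show "c \<subseteq> X closure_of c" by (rule closure_of_subset)
    show "\<phi> ` (X closure_of c) \<subseteq> P" using KP closure_of_subset_topspace[of X c] by blast
  qed
  obtain a b where ab: "\<And>e. e \<in> E \<Longrightarrow> \<phi> ` (X closure_of e) = closed_segment (a e) (b e)"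
    using e by metis
  have "\<exists>\<S>. finite \<S> \<and> (\<forall>s\<in>\<S>. \<exists>a b. s = closed_segment a b) \<and> rel_frontier (\<phi> ` (X closure_of f)) = \<Union>\<S>"
    if "f \<in> F" for f
    using f[OF that] unfolding planar_polygon_def by blast
  then obtain \<S> where \<S>: "\<And>f. f \<in> F \<Longrightarrow> finite (\<S> f)"
    "\<And>f s. f \<in> F \<Longrightarrow> s \<in> \<S> f \<Longrightarrow> \<exists>a b. s = closed_segment a b"
    "\<And>f. f \<in> F \<Longrightarrow> rel_frontier (\<phi> ` (X closure_of f)) = \<Union>(\<S> f)"
    by metis
  have "\<forall>s\<in>\<Union>(\<S> ` F). \<exists>a b. s = closed_segment a b" using \<S>(2) by blast
  then obtain a' b' where "\<forall>s\<in>\<Union>(\<S> ` F). s = closed_segment (a' s) (b' s)" by metis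
  then have ab': "s = closed_segment (a' s) (b' s)" if "f \<in> F" "s \<in> \<S> f" for f s using that by blast
  define Z where "Z = \<phi> ` V \<union> (\<Union>e\<in>E. {a e, b e}) \<union> (\<Union>f\<in>F. \<Union>s\<in>\<S> f. {a' s, b' s})"
  have "finite Z" unfolding Z_def using fin \<S>(1) by auto
  moreover have "v \<in> Z" if v: "v extreme_point_of P" for v
  proof -
    have "v \<in> \<phi> ` topspace X" using v extreme_point_of_convex_hull unfolding P_def by blast
    then obtain x where x: "x \<in> topspace X" "v = \<phi> x" by blast
    then consider "x \<in> V" | c where "c \<in> E" "x \<in> c" | c where "c \<in> F" "x \<in> c"
      using un by blast
    then show ?thesis
    proof cases
      case 1
      then show ?thesis unfolding Z_def using x by blast
    next
      case 2
      then have "v \<in> closed_segment (a c) (b c)" "closed_segment (a c) (b c) \<subseteq> P"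
        using ab[of c] cl[of c] x by auto
      then have "v = a c \<or> v = b c" using extreme_point_in_segment[OF v] by blast
      then show ?thesis unfolding Z_def using 2 by blast
    next
      case 3
      define Q where "Q = \<phi> ` (X closure_of c)"
      have Q: "aff_dim Q = 2" "compact Q"
        using f[OF 3(1)] unfolding planar_polygon_def Q_def
        by (auto simp: homeomorphic_compactness)
      have QP: "Q \<subseteq> P" "v \<in> Q" using cl[of c] 3 x unfolding Q_def by auto
      then have "v extreme_point_of Q" using v extreme_point_of_mono by blast
      moreover have "Q \<noteq> {v}" using Q(1) by auto
      ultimately have "v \<notin> rel_interior Q" by (rule extreme_point_not_in_REL_INTERIOR)
      then have "v \<in> rel_frontier Q" using QP(2) closure_subset unfolding rel_frontier_def by blast
      then obtain s where s: "s \<in> \<S> c" "v \<in> s" using \<S>(3)[OF 3(1)] unfolding Q_def by auto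
      have "s \<subseteq> rel_frontier Q" using \<S>(3)[OF 3(1)] s(1) unfolding Q_def by auto
      then have "s \<subseteq> P"
        using QP(1) compact_imp_closed[OF Q(2)] unfolding rel_frontier_def by auto
      then have "v = a' s \<or> v = b' s"
        using extreme_point_in_segment[OF v, of "a' s" "b' s"] ab'[OF 3(1) s(1)] s(2) by simp
      then show ?thesis unfolding Z_def using 3 s by blast
    qed
  qed
  ultimately show ?thesis
    unfolding P_def[symmetric] by (metis finite_subset mem_Collect_eq subsetI)
qed

lemma polytope_convex_hull:
  fixes K :: "'b::euclidean_space set"
  assumes "compact K" "finite {v. v extreme_point_of (convex hull K)}"
  shows "polytope (convex hull K)"
  using Krein_Milman_Minkowski[OF compact_convex_hull[OF assms(1)] convex_convex_hull] assms(2)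
  unfolding polytope_def by blast

text \<open>A linear functional attains its maximum on a compact set, which leaves room below
  \<open>b\<close>. It turns a hyperplane that misses \<open>K\<close> into an open half-space
  containing \<open>K\<close> with its bounding hyperplane moved inwards.\<close>

lemma strict_upper_bound:
  fixes K :: "'b::euclidean_space set"
  assumes "compact K" "\<And>y. y \<in> K \<Longrightarrow> a \<bullet> y < b"
  obtains m where "m < b" "\<And>y. y \<in> K \<Longrightarrow> a \<bullet> y < m"
proof (cases "K = {}")
  case True
  then show ?thesis using that[of "b - 1"] by simp
next
  case False
  have "continuous_on K (\<lambda>y. a \<bullet> y)" by (intro continuous_intros)
  then obtain z where z: "z \<in> K" "\<And>y. y \<in> K \<Longrightarrow> a \<bullet> y \<le> a \<bullet> z"
    using continuous_attains_sup[OF assms(1) False] by metis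
  have "a \<bullet> z < b" using assms(2) z(1) by blast
  then show ?thesis
    using that[of "(a \<bullet> z + b) / 2"] z(2) by fastforce
qed

text \<open>Suppose \<open>x\<close> on an edge from \<open>u\<close> to \<open>w\<close> is missing
  from \<open>K\<close>. The hyperplane through \<open>x\<close> orthogonal to the edge meets the
  edge only in \<open>x\<close>, so its part \<open>K0\<close> of \<open>K\<close> stays away from
  the supporting hyperplane of the edge. A thin cap of \<open>K\<close> along the edge then avoids
  \<open>K0\<close>, although it is connected by 0-tightness and contains \<open>u\<close> and
  \<open>w\<close> on the two sides.\<close>

lemma zero_tight_skeleton:
  fixes \<phi> :: "'a \<Rightarrow> 'b::euclidean_space" and X :: "'a topology"
  defines "K \<equiv> \<phi> ` topspace X"
  assumes tight: "p_tight 0 X \<phi>" and K: "path_connected K" "compact K" and P: "polytope (convex hull K)"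
  shows "face_skeleton 1 (convex hull K) \<subseteq> K"
proof
  fix x assume "x \<in> face_skeleton 1 (convex hull K)"
  then obtain F where F: "F face_of convex hull K" "aff_dim F \<le> 1" "x \<in> F"
    unfolding face_skeleton_def by auto
  show "x \<in> K"
  proof (rule ccontr)
    assume "x \<notin> K"
    have "polytope F" using F(1) P face_of_polytope_polytope by blast
    then have "compact F" "convex F" by (auto simp: polytope_imp_compact polytope_imp_convex)
    moreover have "collinear F" using F(2) collinear_aff_dim by blast
    ultimately obtain u w where uw: "F = closed_segment u w"
      using compact_convex_collinear_segment F(3) by (metis empty_iff)
    have "u extreme_point_of F" "w extreme_point_of F"
      unfolding uw by (auto simp: extreme_point_of_segment)
    then have uK: "u \<in> K" "w \<in> K"
      using extreme_point_of_face[OF F(1)] extreme_point_of_convex_hull by blast+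
    obtain s where s: "x = (1 - s) *\<^sub>R u + s *\<^sub>R w" "0 \<le> s" "s \<le> 1"
      using F(3) unfolding uw in_segment by blast
    have "s \<noteq> 0" "s \<noteq> 1" "u \<noteq> w" using s uK \<open>x \<notin> K\<close> by (auto simp flip: scaleR_left_distrib)
    define c where "c = w - u"
    have cc: "0 < c \<bullet> c" unfolding c_def using \<open>u \<noteq> w\<close> by simp
    have val: "c \<bullet> ((1 - r) *\<^sub>R u + r *\<^sub>R w) = c \<bullet> u + r * (c \<bullet> c)" for r
      unfolding c_def by (simp add: inner_simps algebra_simps)
    obtain \<alpha> \<beta> where ab: "convex hull K \<subseteq> {y. \<alpha> \<bullet> y \<le> \<beta>}" "F = convex hull K \<inter> {y. \<alpha> \<bullet> y = \<beta>}"
      using F(1) P exposed_face_of_polyhedron polytope_imp_polyhedron unfolding exposed_face_of_def by metis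
    have KP: "K \<subseteq> convex hull K" by (rule hull_subset)
    have only: "y = x" if y: "y \<in> F" "c \<bullet> y = c \<bullet> x" for y
    proof -
      obtain r where "y = (1 - r) *\<^sub>R u + r *\<^sub>R w" using y(1) unfolding uw in_segment by blast
      then show ?thesis using y(2) s(1) val cc by auto
    qed
    define K0 where "K0 = K \<inter> {y. c \<bullet> y = c \<bullet> x}"
    have "compact K0" unfolding K0_def by (intro compact_Int_closed K closed_hyperplane)
    moreover have "\<alpha> \<bullet> y < \<beta>" if "y \<in> K0" for y
      using that only[of y] ab KP \<open>x \<notin> K\<close> unfolding K0_def by fastforce
    ultimately obtain m where m: "m < \<beta>" "\<And>y. y \<in> K0 \<Longrightarrow> \<alpha> \<bullet> y < m"
      using strict_upper_bound by blast
    define C where "C = K \<inter> {y. - \<alpha> \<bullet> y < - m}"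
    have "connected C"
    proof (cases "\<alpha> = 0")
      \<comment> \<open>The exposing functional may vanish when the edge is the whole hull; the cap
        is then all of \<open>K\<close> or empty.\<close>
      case True
      then have "C = K \<or> C = {}" unfolding C_def by auto
      then show ?thesis using K(1) path_connected_imp_connected by auto
    next
      case False
      then show ?thesis
        using zero_tight_connected[OF tight, of "- \<alpha>" "- m"] K(1) unfolding C_def K_def by simp
    qed
    moreover have "u \<in> F" "w \<in> F" unfolding uw by auto
    then have "u \<in> C" "w \<in> C" using uK ab(2) m(1) unfolding C_def by auto
    moreover have "c \<bullet> u \<le> c \<bullet> x" "c \<bullet> x \<le> c \<bullet> w"
      using s cc val[of s] val[of 1] by (auto simp: mult_le_cancel_right1)
    ultimately obtain z where "z \<in> C" "c \<bullet> z = c \<bullet> x"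
      using connected_ivt_hyperplane by blast
    then show False using m(2)[of z] unfolding C_def K0_def by auto
  qed
qed

text \<open>The loop given by \<open>j\<close> bounds in \<open>K\<close> because \<open>j\<close>
  fills it. It is compact and avoids the exposed point \<open>\<phi> p\<close>, so it lies in an
  open half-space that omits \<open>\<phi> p\<close>. By 1-tightness it bounds there too, which the
  turns of \<open>f\<close> forbid.\<close>

lemma one_tight_extreme_not_detectable:
  fixes \<phi> :: "'a \<Rightarrow> 'b::euclidean_space" and X :: "'a topology"
  defines "K \<equiv> \<phi> ` topspace X"
  assumes tight: "p_tight 1 X \<phi>" and emb: "homeomorphic_maps X (top_of_set K) \<phi> \<psi>"
    and P: "polytope (convex hull K)" "0 < aff_dim (convex hull K)"
    and v: "\<phi> p extreme_point_of (convex hull K)" and p: "p \<in> topspace X"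
  shows "\<not> detectable_puncture X p"
proof
  assume "detectable_puncture X p"
  then obtain f :: "'a \<Rightarrow> complex" and j where f: "continuous_map (subtopology X (topspace X - {p})) euclidean f"
    "\<And>x. x \<in> topspace X - {p} \<Longrightarrow> f x \<noteq> 0"
    and j: "continuous_map (top_of_set (cball 0 1)) X j" "p \<notin> j ` sphere 0 1"
    and turn: "\<And>z. z \<in> sphere 0 1 \<Longrightarrow> f (j z) / z \<notin> \<real>\<^sub>\<le>\<^sub>0"
    unfolding detectable_puncture_def by blast
  have \<phi>: "continuous_map X (top_of_set K) \<phi>" and \<psi>: "continuous_map (top_of_set K) X \<psi>"
    and \<psi>\<phi>: "\<And>x. x \<in> topspace X \<Longrightarrow> \<psi> (\<phi> x) = x" and \<phi>\<psi>: "\<And>y. y \<in> K \<Longrightarrow> \<phi> (\<psi> y) = y"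
    using emb unfolding homeomorphic_maps_def by auto
  have \<psi>X: "\<psi> y \<in> topspace X" if "y \<in> K" for y
    using continuous_map_image_subset_topspace[OF \<psi>] that by auto
  have jX: "j z \<in> topspace X" if "z \<in> cball 0 1" for z
    using continuous_map_image_subset_topspace[OF j(1)] that by auto
  have KP: "K \<subseteq> convex hull K" by (rule hull_subset)
  have "{\<phi> p} exposed_face_of convex hull K"
    using v P(1) by (simp add: exposed_face_of_polyhedron polytope_imp_polyhedron face_of_singleton)
  then obtain \<alpha> \<beta> where ab: "convex hull K \<subseteq> {y. \<alpha> \<bullet> y \<le> \<beta>}" "{\<phi> p} = convex hull K \<inter> {y. \<alpha> \<bullet> y = \<beta>}"
    unfolding exposed_face_of_def by metis
  have less: "\<alpha> \<bullet> y < \<beta>" if "y \<in> K" "y \<noteq> \<phi> p" for y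
    using that ab KP by fastforce
  have "\<alpha> \<noteq> 0"
  proof
    assume "\<alpha> = 0"
    then have "convex hull K = {\<phi> p}" using ab by auto
    then show False using P(2) by simp
  qed
  define J where "J = \<phi> \<circ> j"
  have "continuous_map (top_of_set (cball 0 1)) (top_of_set K) J"
    unfolding J_def using j(1) \<phi> by (rule continuous_map_compose)
  then have J: "continuous_on (cball 0 1) J" "J ` cball 0 1 \<subseteq> K"
    by auto
  have sph: "sphere 0 1 \<subseteq> cball (0::complex) 1" by auto
  have Js: "continuous_on (sphere 0 1) J" using J(1) sph continuous_on_subset by blast
  then have "compact (J ` sphere 0 1)" by (intro compact_continuous_image) auto
  moreover have "\<alpha> \<bullet> y < \<beta>" if y: "y \<in> J ` sphere 0 1" for y
  proof (rule less)
    obtain z where z: "z \<in> sphere 0 1" "y = \<phi> (j z)" using y unfolding J_def by auto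
    then have "j z \<in> topspace X" "j z \<noteq> p" using jX sph j(2) by blast+
    then show "y \<noteq> \<phi> p" using z(2) \<psi>\<phi> p by metis
    show "y \<in> K" using y J(2) sph by blast
  qed
  ultimately obtain m where m: "m < \<beta>" "\<And>y. y \<in> J ` sphere 0 1 \<Longrightarrow> \<alpha> \<bullet> y < m"
    using strict_upper_bound by blast
  define T where "T = K \<inter> {y. \<alpha> \<bullet> y < m}"
  have JT: "J ` sphere 0 1 \<subseteq> T" using m(2) J(2) sph unfolding T_def by blast
  define c where "c = Poly_Mapping.single (loop_simplex J) (1::bit)"
  have "c \<in> carrier (mod2_chain_group 1 (top_of_set T))"
    unfolding c_def using singular_simplex_loop_simplex[OF Js JT] by simp
  moreover have "mod2_boundary 1 c = 0" unfolding c_def by (rule mod2_boundary_loop_simplex)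
  moreover have "c \<in> mod2_boundaries 1 (top_of_set K)" unfolding c_def using J by (rule loop_simplex_boundary)
  ultimately have "c \<in> mod2_boundaries 1 (top_of_set T)"
    using p_tightD[OF tight \<open>\<alpha> \<noteq> 0\<close>, of c m] unfolding T_def K_def by blast
  moreover have "c \<notin> mod2_boundaries 1 (top_of_set T)"
    unfolding c_def
  proof (rule loop_simplex_not_boundary[OF _ _ Js JT])
    have \<psi>T: "\<psi> y \<in> topspace X - {p}" if "y \<in> T" for y
    proof -
      have "\<alpha> \<bullet> \<phi> p = \<beta>" using ab(2) by blast
      then have "y \<in> K" "y \<noteq> \<phi> p" using that m(1) unfolding T_def by auto
      then show ?thesis using \<psi>X \<phi>\<psi> by fastforce
    qed
    have "T \<subseteq> K" unfolding T_def by blast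
    then have "continuous_map (top_of_set T) X \<psi>"
      using \<psi> continuous_map_from_subtopology_mono by blast
    then have "continuous_map (top_of_set T) (subtopology X (topspace X - {p})) \<psi>"
      using \<psi>T by (simp add: continuous_map_in_subtopology)
    then have "continuous_map (top_of_set T) euclidean (f \<circ> \<psi>)"
      using f(1) continuous_map_compose by blast
    then show "continuous_on T (f \<circ> \<psi>)" by simp
    show "(f \<circ> \<psi>) y \<noteq> 0" if "y \<in> T" for y using \<psi>T[OF that] f(2) by simp
    show "(f \<circ> \<psi>) (J z) / z \<notin> \<real>\<^sub>\<le>\<^sub>0" if "z \<in> sphere 0 1" for z
      using turn[OF that] \<psi>\<phi> jX that unfolding J_def by simp
  qed
  ultimately show False by blast
qed

section \<open>The complete graph: realization and colouring\<close>

lemma graph_realization_complete: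
  "graph_realization {..n} (nsets {..n} 2) = top_of_set (complete_realization n)"
proof -
  have "{x. (\<forall>v. 0 \<le> x v) \<and> {v. x v \<noteq> 0} \<in> (\<lambda>v. {v}) ` {..n} \<union> nsets {..n} 2 \<and> (\<Sum>v\<in>{..n}. x v) = 1} =
      complete_realization n" (is "?L = ?R")
  proof
    show "?L \<subseteq> ?R"
    proof
      fix x assume "x \<in> ?L"
      then have nn: "\<And>v. 0 \<le> x v" and sum: "(\<Sum>v\<in>{..n}. x v) = 1"
        and supp: "{v. x v \<noteq> 0} \<in> (\<lambda>v. {v}) ` {..n} \<union> nsets {..n} 2" by auto
      obtain i k where ik: "i \<le> n" "k \<le> n" "{v. x v \<noteq> 0} = {i, k}"
      proof -
        have "\<exists>i k. i \<le> n \<and> k \<le> n \<and> {v. x v \<noteq> 0} = {i, k}"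
          using supp
        proof
          assume "{v. x v \<noteq> 0} \<in> nsets {..n} 2"
          then have "card {v. x v \<noteq> 0} = 2" "{v. x v \<noteq> 0} \<subseteq> {..n}" by (auto simp: nsets_def)
          then show ?thesis unfolding card_2_iff by (metis atMost_iff insert_subset)
        next
          assume "{v. x v \<noteq> 0} \<in> (\<lambda>v. {v}) ` {..n}"
          then obtain i where "i \<le> n" "{v. x v \<noteq> 0} = {i}" by auto
          then show ?thesis by (intro exI[of _ i]) simp
        qed
        then show ?thesis using that by blast
      qed
      then have zero: "x v = 0" if "v \<noteq> i" "v \<noteq> k" for v using that by blast
      have sum': "(\<Sum>v\<in>{i, k}. x v) = 1"
        using sum ik zero sum.mono_neutral_left[of "{..n}" "{i, k}" x] by auto
      show "x \<in> ?R"
      proof (cases "i = k")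
        case True
        then have "x = vertex_point i" using sum' zero by (auto simp: vertex_point_def)
        then show ?thesis using ik vertex_point_in_complete_realization by blast
      next
        case False
        then have s: "x i + x k = 1" using sum' by simp
        then have "x = edge_point i k (x k)"
          using zero False by (auto simp: edge_point_def vertex_point_def fun_eq_iff)
        moreover have "x k \<le> 1" using s nn[of i] by linarith
        ultimately show ?thesis unfolding mem_complete_realization using ik nn by blast
      qed
    qed
    show "?R \<subseteq> ?L"
    proof
      fix x assume "x \<in> ?R"
      then obtain i k t where ik: "i \<le> n" "k \<le> n" and t: "0 \<le> t" "t \<le> 1" and x: "x = edge_point i k t"
        unfolding mem_complete_realization by blast
      have nn: "0 \<le> x v" for v using x t by (auto simp: edge_point_def vertex_point_def)
      have "(\<Sum>v\<in>{..n}. vertex_point u v) = (1::real)" if "u \<le> n" for u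
        using that by (simp add: vertex_point_def)
      then have sum: "(\<Sum>v\<in>{..n}. x v) = 1"
        unfolding x edge_point_def sum.distrib sum_distrib_left[symmetric] using ik by simp
      have sing: "{v. vertex_point u v \<noteq> 0} = {u}" for u :: nat by (auto simp: vertex_point_def)
      consider "i = k \<or> t = 0" | "t = 1" | "i \<noteq> k" "0 < t" "t < 1" using t by linarith
      then have "{v. x v \<noteq> 0} \<in> (\<lambda>v. {v}) ` {..n} \<union> nsets {..n} 2"
      proof cases
        case 3
        then have "{v. x v \<noteq> 0} = {i, k}" unfolding x by (auto simp: edge_point_def vertex_point_def)
        moreover have "{i, k} \<in> nsets {..n} 2" using 3 ik by (auto simp: nsets_def)
        ultimately show ?thesis by simp
      qed (use x ik sing in auto)
      then show "x \<in> ?L" using nn sum by blast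
    qed
  qed
  then show ?thesis unfolding graph_realization_def by (simp add: euclidean_product_topology)
qed

lemma chromatic_number_complete: "Suc n \<le> chromatic_number {..n} (nsets {..n} 2)"
proof -
  have le: "Suc n \<le> k" if "proper_colouring {..n} (nsets {..n} 2) k c" for k c
  proof -
    have "inj_on c {..n}"
    proof (rule inj_onI)
      fix u v assume uv: "u \<in> {..n}" "v \<in> {..n}" "c u = c v"
      show "u = v"
      proof (rule ccontr)
        assume "u \<noteq> v"
        then have "{u, v} \<in> nsets {..n} 2" using uv by (auto simp: nsets_def)
        then show False using that uv(3) unfolding proper_colouring_def by blast
      qed
    qed
    moreover have "c ` {..n} \<subseteq> {..<k}" using that unfolding proper_colouring_def by blast
    ultimately have "card {..n} \<le> card {..<k}" by (intro card_inj_on_le) auto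
    then show ?thesis by simp
  qed
  \<comment> \<open>Some proper colouring has to exist before \<open>LEAST\<close> denotes an
    attained number of colours.\<close>
  have "proper_colouring {..n} (nsets {..n} 2) (Suc n) id"
    unfolding proper_colouring_def nsets_def by (auto simp: card_2_iff doubleton_eq_iff)
  then have "\<exists>c. proper_colouring {..n} (nsets {..n} 2) (chromatic_number {..n} (nsets {..n} 2)) c"
    unfolding chromatic_number_def by (intro LeastI_ex[of "\<lambda>k. \<exists>c. proper_colouring {..n} (nsets {..n} 2) k c"] exI)
  then show ?thesis using le by blast
qed

theorem mainTheorem1:
  fixes S :: "'a topology" and \<phi> :: "'a \<Rightarrow> real ^ 'n"
  assumes "surface S" and "compact_space S" and "connected_space S"
    and "surface_boundary S \<noteq> {}"
    and "polyhedral_embedding S \<phi>" and "substantial S \<phi>" and "tight S \<phi>"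
  shows "enat CARD('n) \<le> relative_chromatic_number S - 1"
proof -
  define K where "K = \<phi> ` topspace S"
  define n where "n = CARD('n)"
  have emb: "embedding_map S euclidean \<phi>" using assms(5) unfolding polyhedral_embedding_def by blast
  then have "homeomorphic_map S (top_of_set K) \<phi>" unfolding embedding_map_def K_def by simp
  then obtain \<psi> where hom: "homeomorphic_maps S (top_of_set K) \<phi> \<psi>" using homeomorphic_map_maps by blast
  have \<phi>: "continuous_map S euclidean \<phi>" and \<psi>: "continuous_map (top_of_set K) S \<psi>"
    and \<psi>\<phi>: "\<And>x. x \<in> topspace S \<Longrightarrow> \<psi> (\<phi> x) = x" and \<phi>\<psi>: "\<And>y. y \<in> K \<Longrightarrow> \<phi> (\<psi> y) = y"
    using hom unfolding homeomorphic_maps_def by (auto simp: continuous_map_in_subtopology)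
  have "compactin euclidean K"
    unfolding K_def using assms(2) \<phi> by (intro image_compactin) (auto simp: compact_space_def)
  then have cK: "compact K" by simp
  have pcK: "path_connected K"
    using path_connectedin_continuous_map_image[OF \<phi>, of "topspace S"]
      surface_path_connected[OF assms(1,3)] unfolding K_def by (simp add: path_connectedin_topspace)
  have P: "polytope (convex hull K)"
    using polytope_convex_hull[OF cK] polyhedral_embedding_finite_extreme_points[OF assms(5)] K_def by simp
  have "\<not> aff_dim K < DIM(real ^ 'n)"
    using assms(6) aff_lowdim_subset_hyperplane unfolding substantial_def K_def by metis
  then have dim: "aff_dim (convex hull K) = int n"
    using aff_dim_le_DIM[of K] unfolding n_def by (simp add: aff_dim_convex_hull)
  \<comment> \<open>An index type is nonempty. Hence the hull is not a point, and a functional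
    exposing one of its vertices is nonzero, as tightness requires.\<close>
  have "0 < n" unfolding n_def by simp
  obtain g where g: "continuous_on (complete_realization n) g" "inj_on g (complete_realization n)"
    "g ` complete_realization n \<subseteq> face_skeleton 1 (convex hull K)"
    "\<And>i. i \<le> n \<Longrightarrow> g (vertex_point i) extreme_point_of (convex hull K)"
    using polytope_complete_graph[OF P dim] by blast
  have tight: "p_tight 0 S \<phi>" "p_tight 1 S \<phi>" using assms(7) unfolding tight_def by auto
  have gK: "g ` complete_realization n \<subseteq> K"
    using g(3) zero_tight_skeleton[OF tight(1)] pcK cK P unfolding K_def by blast
  have bd: "\<psi> v \<in> surface_boundary S" if v: "v extreme_point_of (convex hull K)" for v
  proof -
    have vK: "v \<in> K" using v extreme_point_of_convex_hull by blast
    then have top: "\<psi> v \<in> topspace S" using continuous_map_image_subset_topspace[OF \<psi>] by auto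
    have "\<not> detectable_puncture S (\<psi> v)"
      using one_tight_extreme_not_detectable[OF tight(2), of \<psi> "\<psi> v"] hom P dim \<open>0 < n\<close> v \<phi>\<psi>[OF vK] top
      unfolding K_def by simp
    then have "\<psi> v \<notin> surface_interior S"
      using surface_interior_detectable[OF assms(1,3,4)] by blast
    then show ?thesis unfolding surface_boundary_def using top by blast
  qed
  have "embedding_map (top_of_set (complete_realization n)) S (\<psi> \<circ> g)"
  proof (rule injective_closed_imp_embedding_map)
    have "continuous_map (top_of_set (complete_realization n)) (top_of_set K) g"
      using g(1) gK by auto
    then have cont: "continuous_map (top_of_set (complete_realization n)) S (\<psi> \<circ> g)"
      using \<psi> by (rule continuous_map_compose)
    then show "continuous_map (top_of_set (complete_realization n)) S (\<psi> \<circ> g)" .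
    show "closed_map (top_of_set (complete_realization n)) S (\<psi> \<circ> g)"
      using cont compact_complete_realization assms(1)
      by (intro continuous_imp_closed_map_gen Hausdorff_imp_kc_space) (simp_all add: compact_space_subtopology surface_def)
    have "inj_on \<psi> K" using \<phi>\<psi> by (metis inj_onI)
    then show "inj_on (\<psi> \<circ> g) (topspace (top_of_set (complete_realization n)))"
      using g(2) gK by (simp add: comp_inj_on inj_on_subset)
  qed
  then have "proper_graph_embedding {..n} (nsets {..n} 2) S (\<psi> \<circ> g)"
    unfolding proper_graph_embedding_def graph_realization_complete using bd g(4) by simp
  moreover have "finite_graph {..n} (nsets {..n} 2)" unfolding finite_graph_def by simp
  ultimately have "enat (chromatic_number {..n} (nsets {..n} 2)) \<le> relative_chromatic_number S"
    unfolding relative_chromatic_number_def by (intro Sup_upper) blast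
  then have "enat (Suc n) \<le> relative_chromatic_number S"
    using chromatic_number_complete[of n] by (metis enat_ord_simps(1) order_trans)
  \<comment> \<open>The graph on \<open>{..n}\<close> has \<open>n + 1\<close> vertices, which
    accounts for the subtraction of 1; if the relative chromatic number is infinite, so is the
    difference.\<close>
  then show ?thesis
    unfolding n_def by (cases "relative_chromatic_number S") (auto simp: one_enat_def)
qed

end
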